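(* Let $M$ be a linearly ordered Fraïssé structure whose age has strong amalgamation, and suppose $M$ has a local SWIR. Then $M$ has a Katětov functor, and hence the $\omega$-age of $M$ is extensible.
   Context: A linearly ordered structure is a structure in a first-order language containing a binary relation symbol $\le$ (the language may also contain other relation, function and constant symbols) in which $\le$ is interpreted as a linear order. A Fraïssé structure is a countably infinite structure $M$ that is ultrahomogeneous: every isomorphism between finitely generated substructures extends to an automorphism of $M$. The age of $M$ (finitely generated structures embeddable in $M$) has strong amalgamation if any two embeddings $A\to B$, $A\to C$ in the age can be amalgamated into some $D$ in the age with the images of $B$ and $C$ intersecting exactly in the image of $A$. The $\omega$-age of $M$ is the class of all structures (finite or countably infinite) embeddable in $M$; $\mathcal{A}(M)$, $\mathcal{A}_\omega(M)$ denote the non-empty finitely generated, resp. all non-empty, structures embeddable in $M$, viewed as categories with all embeddings as morphisms. An embedding $f:A\to M$ is extensive if there is a group embedding $\theta:\mathrm{Aut}(f(A))\to\mathrm{Aut}(M)$ with $g\subseteq\theta(g)$ for all $g$; the $\omega$-age is extensible if every member admits an extensive embedding into $M$. A one-point extension in $\mathcal{A}(M)$ is an embedding $\zeta:A\to B$ in $\mathcal{A}(M)$ with $B$ generated by $\zeta(A)\cup\{e\}$ for some $e\in B\setminus\zeta(A)$. A Katětov functor for $M$ is a functor $K:\mathcal{A}(M)\to\mathcal{A}_\omega(M)$ together with embeddings $\eta_A:A\to K(A)$ such that $K(f)\circ\eta_A=\eta_B\circ f$ for all embeddings $f:A\to B$ in $\mathcal{A}(M)$, and for each one-point extension $\zeta:A\to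 B$ there is an embedding $f:B\to K(A)$ with $f\circ\zeta=\eta_A$. A local SWIR on $M$ is a ternary relation $B\mathop{\smile\!\!\!\!\!\!|}_A C$ on finitely generated substructures of $M$ with $A$ non-empty, satisfying (writing $AB$ for the substructure generated by $A\cup B$, all bases non-empty): Invariance under $\mathrm{Aut}(M)$; Existence (for all $A,B,C$ there is $g\in\mathrm{Aut}(M)$ fixing $A$ pointwise with $gB\mathop{\smile\!\!\!\!\!\!|}_A C$, and there is $h$ fixing $A$ pointwise with $B\mathop{\smile\!\!\!\!\!\!|}_A hC$); Stationarity (if $B\mathop{\smile\!\!\!\!\!\!|}_A C$, $B'\mathop{\smile\!\!\!\!\!\!|}_A C$ and an automorphism fixing $A$ pointwise restricts to $\sigma:B\to B'$, then an automorphism fixing $AC$ pointwise restricts to $\sigma$ on $B$; and the symmetric statement on the right side); Monotonicity ($BD\mathop{\smile\!\!\!\!\!\!|}_A C$ implies $B\mathop{\smile\!\!\!\!\!\!|}_A C$ and $D\mathop{\smile\!\!\!\!\!\!|}_{AB}C$; $B\mathop{\smile\!\!\!\!\!\!|}_A CD$ implies $B\mathop{\smile\!\!\!\!\!\!|}_A C$ and $B\mathop{\smile\!\!\!\!\!\!|}_{AC}D$). *)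

theory Defs
  imports "HOL-Algebra.Bij" "HOL-Library.Countable_Set"
begin

section \<open>Structures of a first-order language\<close>

text \<open>
  The symbols of a language are sets rather than whole types, so that a language without function
  symbols or with the order as its only symbol is covered.  Constants are function symbols of
  arity 0.
\<close>

record ('f, 'r) language =
  fun_syms :: "'f set"
  rel_syms :: "'r set"
  fun_arity :: "'f \<Rightarrow> nat"
  rel_arity :: "'r \<Rightarrow> nat"

text \<open>
  Only the values of \<open>fn\<close> and \<open>rel\<close> at symbols of the language and at tuples of
  the right length from the carrier are meaningful; all notions below look at these values only.
  The carrier may be empty.
\<close>

record ('f, 'r, 'a) fo_structure = "'a partial_object" +
  fn :: "'f \<Rightarrow> 'a list \<Rightarrow> 'a"
  rel :: "'r \<Rightarrow> 'a list set"

definition tuples :: "'a set \<Rightarrow> nat \<Rightarrow> 'a list set" where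
  "tuples S n = {xs. length xs = n \<and> set xs \<subseteq> S}"

definition fun_closed :: "('f, 'r) language \<Rightarrow> ('f, 'r, 'a) fo_structure \<Rightarrow> 'a set \<Rightarrow> bool" where
  "fun_closed L A S \<longleftrightarrow>
     (\<forall>f \<in> fun_syms L. \<forall>xs \<in> tuples S (fun_arity L f). fn A f xs \<in> S)"

definition is_structure :: "('f, 'r) language \<Rightarrow> ('f, 'r, 'a) fo_structure \<Rightarrow> bool" where
  "is_structure L A \<longleftrightarrow> fun_closed L A (carrier A)"

definition linearly_ordered_by :: "('f, 'r) language \<Rightarrow> 'r \<Rightarrow> ('f, 'r, 'a) fo_structure \<Rightarrow> bool" where
  "linearly_ordered_by L leq A \<longleftrightarrow>
     leq \<in> rel_syms L \<and> rel_arity L leq = 2 \<and>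
     linear_order_on (carrier A) {(x, y) \<in> carrier A \<times> carrier A. [x, y] \<in> rel A leq}"

text \<open>
  Substructures are given by their carriers; \<open>induced A S\<close> is the structure that
  \<open>A\<close> induces on the subset \<open>S\<close>.
\<close>

definition induced :: "('f, 'r, 'a) fo_structure \<Rightarrow> 'a set \<Rightarrow> ('f, 'r, 'a) fo_structure" where
  "induced A S = A\<lparr>carrier := S\<rparr>"

definition generated :: "('f, 'r) language \<Rightarrow> ('f, 'r, 'a) fo_structure \<Rightarrow> 'a set \<Rightarrow> 'a set" where
  "generated L A X = \<Inter>{S. X \<subseteq> S \<and> S \<subseteq> carrier A \<and> fun_closed L A S}"

definition fin_gen_sub :: "('f, 'r) language \<Rightarrow> ('f, 'r, 'a) fo_structure \<Rightarrow> 'a set \<Rightarrow> bool" where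
  "fin_gen_sub L A S \<longleftrightarrow> (\<exists>X. finite X \<and> X \<subseteq> carrier A \<and> S = generated L A X)"

definition fin_gen :: "('f, 'r) language \<Rightarrow> ('f, 'r, 'a) fo_structure \<Rightarrow> bool" where
  "fin_gen L A \<longleftrightarrow> fin_gen_sub L A (carrier A)"


section \<open>Embeddings and automorphisms\<close>

text \<open>
  Embeddings are extensional functions, so that equality of functions is equality of morphisms;
  composition of morphisms is \<open>compose\<close>.
\<close>

definition embeddings ::
    "('f, 'r) language \<Rightarrow> ('f, 'r, 'a) fo_structure \<Rightarrow> ('f, 'r, 'b) fo_structure \<Rightarrow> ('a \<Rightarrow> 'b) set" where
  "embeddings L A B = {h \<in> carrier A \<rightarrow>\<^sub>E carrier B.
     inj_on h (carrier A) \<and>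
     (\<forall>f \<in> fun_syms L. \<forall>xs \<in> tuples (carrier A) (fun_arity L f).
        h (fn A f xs) = fn B f (map h xs)) \<and>
     (\<forall>R \<in> rel_syms L. \<forall>xs \<in> tuples (carrier A) (rel_arity L R).
        xs \<in> rel A R \<longleftrightarrow> map h xs \<in> rel B R)}"

definition isomorphisms ::
    "('f, 'r) language \<Rightarrow> ('f, 'r, 'a) fo_structure \<Rightarrow> ('f, 'r, 'b) fo_structure \<Rightarrow> ('a \<Rightarrow> 'b) set" where
  "isomorphisms L A B = {h \<in> embeddings L A B. h ` carrier A = carrier B}"

definition automorphisms :: "('f, 'r) language \<Rightarrow> ('f, 'r, 'a) fo_structure \<Rightarrow> ('a \<Rightarrow> 'a) set" where
  "automorphisms L A = isomorphisms L A A"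

definition aut_group :: "('f, 'r) language \<Rightarrow> ('f, 'r, 'a) fo_structure \<Rightarrow> ('a \<Rightarrow> 'a) monoid" where
  "aut_group L A = (BijGroup (carrier A))\<lparr>carrier := automorphisms L A\<rparr>"

definition aut_fixing :: "('f, 'r) language \<Rightarrow> ('f, 'r, 'a) fo_structure \<Rightarrow> 'a set \<Rightarrow> ('a \<Rightarrow> 'a) set" where
  "aut_fixing L A S = {g \<in> automorphisms L A. \<forall>x \<in> S. g x = x}"


section \<open>Fraisse structures, ages and strong amalgamation\<close>

definition ultrahomogeneous :: "('f, 'r) language \<Rightarrow> ('f, 'r, 'a) fo_structure \<Rightarrow> bool" where
  "ultrahomogeneous L M \<longleftrightarrow>
     (\<forall>A B h. fin_gen_sub L M A \<longrightarrow> fin_gen_sub L M B \<longrightarrow>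
        h \<in> isomorphisms L (induced M A) (induced M B) \<longrightarrow>
        (\<exists>g \<in> automorphisms L M. \<forall>x \<in> A. g x = h x))"

definition fraisse_structure :: "('f, 'r) language \<Rightarrow> ('f, 'r, 'a) fo_structure \<Rightarrow> bool" where
  "fraisse_structure L M \<longleftrightarrow>
     is_structure L M \<and> countable (carrier M) \<and> infinite (carrier M) \<and> ultrahomogeneous L M"

text \<open>
  The members of the classes below are structures with elements in a type \<open>'u\<close> that serves
  as the universe and is independent of the type of elements of \<open>M\<close>.  If \<open>'u\<close> is
  infinite and \<open>M\<close> is countable, then every structure embeddable in \<open>M\<close> has
  an isomorphic copy in it.  The age and the \<open>\<omega>\<close>-age may contain empty structures; the classes of
  objects of the two categories do not.
\<close>

definition omega_age ::
    "('f, 'r) language \<Rightarrow> ('f, 'r, 'a) fo_structure \<Rightarrow> ('f, 'r, 'u) fo_structure set" where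
  "omega_age L M = {A. is_structure L A \<and> embeddings L A M \<noteq> {}}"

definition age ::
    "('f, 'r) language \<Rightarrow> ('f, 'r, 'a) fo_structure \<Rightarrow> ('f, 'r, 'u) fo_structure set" where
  "age L M = {A \<in> omega_age L M. fin_gen L A}"

definition age_objects ::
    "('f, 'r) language \<Rightarrow> ('f, 'r, 'a) fo_structure \<Rightarrow> ('f, 'r, 'u) fo_structure set" where
  "age_objects L M = {A \<in> age L M. carrier A \<noteq> {}}"

definition omega_age_objects ::
    "('f, 'r) language \<Rightarrow> ('f, 'r, 'a) fo_structure \<Rightarrow> ('f, 'r, 'u) fo_structure set" where
  "omega_age_objects L M = {A \<in> omega_age L M. carrier A \<noteq> {}}"

definition strong_amalgamation ::
    "('f, 'r) language \<Rightarrow> ('f, 'r, 'u) fo_structure set \<Rightarrow> bool" where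
  "strong_amalgamation L \<C> \<longleftrightarrow>
     (\<forall>A \<in> \<C>. \<forall>B \<in> \<C>. \<forall>C \<in> \<C>. \<forall>f \<in> embeddings L A B. \<forall>g \<in> embeddings L A C.
        \<exists>D \<in> \<C>. \<exists>f' \<in> embeddings L B D. \<exists>g' \<in> embeddings L C D.
          compose (carrier A) f' f = compose (carrier A) g' g \<and>
          f' ` carrier B \<inter> g' ` carrier C = compose (carrier A) f' f ` carrier A)"


section \<open>Extensive embeddings\<close>

definition extensive_embedding ::
    "('f, 'r) language \<Rightarrow> ('f, 'r, 'u) fo_structure \<Rightarrow> ('f, 'r, 'a) fo_structure \<Rightarrow> ('u \<Rightarrow> 'a) \<Rightarrow> bool" where
  "extensive_embedding L A M f \<longleftrightarrow>
     f \<in> embeddings L A M \<and>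
     (\<exists>\<theta> \<in> mon (aut_group L (induced M (f ` carrier A))) (aut_group L M).
        \<forall>g \<in> automorphisms L (induced M (f ` carrier A)). \<forall>x \<in> f ` carrier A. \<theta> g x = g x)"

definition extensible ::
    "('f, 'r) language \<Rightarrow> ('f, 'r, 'u) fo_structure set \<Rightarrow> ('f, 'r, 'a) fo_structure \<Rightarrow> bool" where
  "extensible L \<C> M \<longleftrightarrow> (\<forall>A \<in> \<C>. \<exists>f. extensive_embedding L A M f)"


section \<open>Katetov functors\<close>

definition one_point_extension ::
    "('f, 'r) language \<Rightarrow> ('f, 'r, 'u) fo_structure \<Rightarrow> ('f, 'r, 'u) fo_structure \<Rightarrow> ('u \<Rightarrow> 'u) \<Rightarrow> bool" where
  "one_point_extension L A B \<zeta> \<longleftrightarrow>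
     \<zeta> \<in> embeddings L A B \<and>
     (\<exists>e \<in> carrier B - \<zeta> ` carrier A. carrier B = generated L B (insert e (\<zeta> ` carrier A)))"

text \<open>
  Functors between classes of structures with all embeddings as morphisms: \<open>Ko\<close> is the
  object part and \<open>Km A B\<close> the action on embeddings from \<open>A\<close> to \<open>B\<close>.
\<close>

definition embedding_functor ::
    "('f, 'r) language \<Rightarrow> ('f, 'r, 'u) fo_structure set \<Rightarrow> ('f, 'r, 'u) fo_structure set \<Rightarrow>
     (('f, 'r, 'u) fo_structure \<Rightarrow> ('f, 'r, 'u) fo_structure) \<Rightarrow>
     (('f, 'r, 'u) fo_structure \<Rightarrow> ('f, 'r, 'u) fo_structure \<Rightarrow> ('u \<Rightarrow> 'u) \<Rightarrow> ('u \<Rightarrow> 'u)) \<Rightarrow> bool" where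
  "embedding_functor L \<C> \<D> Ko Km \<longleftrightarrow>
     (\<forall>A \<in> \<C>. Ko A \<in> \<D>) \<and>
     (\<forall>A \<in> \<C>. \<forall>B \<in> \<C>. \<forall>f \<in> embeddings L A B. Km A B f \<in> embeddings L (Ko A) (Ko B)) \<and>
     (\<forall>A \<in> \<C>. Km A A (\<lambda>x \<in> carrier A. x) = (\<lambda>x \<in> carrier (Ko A). x)) \<and>
     (\<forall>A \<in> \<C>. \<forall>B \<in> \<C>. \<forall>C \<in> \<C>. \<forall>f \<in> embeddings L A B. \<forall>g \<in> embeddings L B C.
        Km A C (compose (carrier A) g f) = compose (carrier (Ko A)) (Km B C g) (Km A B f))"

definition katetov_functor ::
    "('f, 'r) language \<Rightarrow> ('f, 'r, 'a) fo_structure \<Rightarrow>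
     (('f, 'r, 'u) fo_structure \<Rightarrow> ('f, 'r, 'u) fo_structure) \<Rightarrow>
     (('f, 'r, 'u) fo_structure \<Rightarrow> ('f, 'r, 'u) fo_structure \<Rightarrow> ('u \<Rightarrow> 'u) \<Rightarrow> ('u \<Rightarrow> 'u)) \<Rightarrow>
     (('f, 'r, 'u) fo_structure \<Rightarrow> 'u \<Rightarrow> 'u) \<Rightarrow> bool" where
  "katetov_functor L M Ko Km \<eta> \<longleftrightarrow>
     embedding_functor L (age_objects L M) (omega_age_objects L M) Ko Km \<and>
     (\<forall>A \<in> age_objects L M. \<eta> A \<in> embeddings L A (Ko A)) \<and>
     (\<forall>A \<in> age_objects L M. \<forall>B \<in> age_objects L M. \<forall>f \<in> embeddings L A B.
        compose (carrier A) (Km A B f) (\<eta> A) = compose (carrier A) (\<eta> B) f) \<and>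
     (\<forall>A \<in> age_objects L M. \<forall>B \<in> age_objects L M. \<forall>\<zeta>. one_point_extension L A B \<zeta> \<longrightarrow>
        (\<exists>f \<in> embeddings L B (Ko A). compose (carrier A) f \<zeta> = \<eta> A))"


section \<open>Local stationary weak independence relations\<close>

text \<open>
  \<open>ind B A C\<close> reads ``\<open>B\<close> is independent from \<open>C\<close> over \<open>A\<close>''.
  The values of \<open>ind\<close> matter only for (carriers of) finitely generated substructures
  with a non-empty base \<open>A\<close>.
\<close>

definition swir_invariance ::
    "('f, 'r) language \<Rightarrow> ('f, 'r, 'a) fo_structure \<Rightarrow> ('a set \<Rightarrow> 'a set \<Rightarrow> 'a set \<Rightarrow> bool) \<Rightarrow> bool" where
  "swir_invariance L M ind \<longleftrightarrow>
     (\<forall>A B C. fin_gen_sub L M A \<and> A \<noteq> {} \<and> fin_gen_sub L M B \<and> fin_gen_sub L M C \<longrightarrow>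
        (\<forall>g \<in> automorphisms L M. ind B A C \<longrightarrow> ind (g ` B) (g ` A) (g ` C)))"

definition swir_existence ::
    "('f, 'r) language \<Rightarrow> ('f, 'r, 'a) fo_structure \<Rightarrow> ('a set \<Rightarrow> 'a set \<Rightarrow> 'a set \<Rightarrow> bool) \<Rightarrow> bool" where
  "swir_existence L M ind \<longleftrightarrow>
     (\<forall>A B C. fin_gen_sub L M A \<and> A \<noteq> {} \<and> fin_gen_sub L M B \<and> fin_gen_sub L M C \<longrightarrow>
        (\<exists>g \<in> aut_fixing L M A. ind (g ` B) A C) \<and>
        (\<exists>h \<in> aut_fixing L M A. ind B A (h ` C)))"

definition swir_stationarity ::
    "('f, 'r) language \<Rightarrow> ('f, 'r, 'a) fo_structure \<Rightarrow> ('a set \<Rightarrow> 'a set \<Rightarrow> 'a set \<Rightarrow> bool) \<Rightarrow> bool" where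
  "swir_stationarity L M ind \<longleftrightarrow>
     (\<forall>A B B' C. fin_gen_sub L M A \<and> A \<noteq> {} \<and>
        fin_gen_sub L M B \<and> fin_gen_sub L M B' \<and> fin_gen_sub L M C \<longrightarrow>
        ind B A C \<longrightarrow> ind B' A C \<longrightarrow>
        (\<forall>h \<in> aut_fixing L M A. h ` B = B' \<longrightarrow>
           (\<exists>g \<in> aut_fixing L M (generated L M (A \<union> C)). \<forall>x \<in> B. g x = h x))) \<and>
     (\<forall>A B C C'. fin_gen_sub L M A \<and> A \<noteq> {} \<and>
        fin_gen_sub L M B \<and> fin_gen_sub L M C \<and> fin_gen_sub L M C' \<longrightarrow>
        ind B A C \<longrightarrow> ind B A C' \<longrightarrow>
        (\<forall>h \<in> aut_fixing L M A. h ` C = C' \<longrightarrow>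
           (\<exists>g \<in> aut_fixing L M (generated L M (A \<union> B)). \<forall>x \<in> C. g x = h x)))"

definition swir_monotonicity ::
    "('f, 'r) language \<Rightarrow> ('f, 'r, 'a) fo_structure \<Rightarrow> ('a set \<Rightarrow> 'a set \<Rightarrow> 'a set \<Rightarrow> bool) \<Rightarrow> bool" where
  "swir_monotonicity L M ind \<longleftrightarrow>
     (\<forall>A B C D. fin_gen_sub L M A \<and> A \<noteq> {} \<and>
        fin_gen_sub L M B \<and> fin_gen_sub L M C \<and> fin_gen_sub L M D \<longrightarrow>
        (ind (generated L M (B \<union> D)) A C \<longrightarrow>
           ind B A C \<and> ind D (generated L M (A \<union> B)) C) \<and>
        (ind B A (generated L M (C \<union> D)) \<longrightarrow>
           ind B A C \<and> ind B (generated L M (A \<union> C)) D))"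

definition local_swir ::
    "('f, 'r) language \<Rightarrow> ('f, 'r, 'a) fo_structure \<Rightarrow> ('a set \<Rightarrow> 'a set \<Rightarrow> 'a set \<Rightarrow> bool) \<Rightarrow> bool" where
  "local_swir L M ind \<longleftrightarrow>
     swir_invariance L M ind \<and> swir_existence L M ind \<and>
     swir_stationarity L M ind \<and> swir_monotonicity L M ind"

end

theory Submission
  imports Defs
begin

text \<open>
  Consider trees whose leaves are labelled by elements of a structure \<open>A\<close> and whose inner nodes carry
  a (code of a) type over the tuple of their children.  The linear order of \<open>A\<close> induces a linear order
  of these trees that every embedding of \<open>A\<close> preserves.  Assign elements of \<open>M\<close> to the trees such that
  the leaves form a copy of \<open>A\<close> and each inner node realises its type over its children independently,
  over its children, from everything below it in the order.  By stationarity and monotonicity the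
  joint type of any finite set of trees is determined, so an embedding \<open>A \<rightarrow> B\<close> acts on
  the values by relabelling leaves.  A back-and-forth construction makes the assignment surjective
  onto \<open>M\<close>.  Thus all structures of the \<open>\<omega>\<close>-age embed into \<open>M\<close> so that embeddings between them extend
  functorially to self-embeddings of \<open>M\<close>; this is a Katetov functor with constant value \<open>M\<close>, and its
  action on automorphisms of \<open>A\<close> shows that the embedding of \<open>A\<close> is extensive.
\<close>


section \<open>Trees over a linearly ordered set\<close>

text \<open>Independence is not assumed symmetric, so the joint type of several independent
  realisations may depend on the order in which they are added; hence the need for an order of the
  trees that relabelling respects. That order need not be well-founded: a node may have infinitely
  many trees below it, and a tree considered later may fall below a node that already has a value.
  Values can therefore not be chosen by recursion along the order. Instead, assignments are studied
  on finite subtree-closed sets, where existence and uniqueness up to an automorphism follow by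
  induction on the greatest tree; together they allow the set to grow while the old values are kept.
  Many trees may denote the same element. This is harmless, since equality of values is part of the
  joint type that relabelling preserves. A node has a first child besides the list of the others
  because independence is available over non-empty bases only.\<close>

datatype 'u tree = Leaf 'u | Node "'u tree" "'u tree list" nat

abbreviation trees_over :: "'u set \<Rightarrow> 'u tree set" where
  "trees_over S \<equiv> {w. set_tree w \<subseteq> S}"

definition subtree_closed :: "'u tree set \<Rightarrow> bool" where
  "subtree_closed T \<longleftrightarrow> (\<forall>w ws t. Node w ws t \<in> T \<longrightarrow> set (w # ws) \<subseteq> T)"

lemma subtree_closedD: "subtree_closed T \<Longrightarrow> Node w ws t \<in> T \<Longrightarrow> set (w # ws) \<subseteq> T"
  unfolding subtree_closed_def by blast

lemma subtree_closed_Un: "subtree_closed T \<Longrightarrow> subtree_closed T' \<Longrightarrow> subtree_closed (T \<union> T')"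
  unfolding subtree_closed_def by blast

lemma subtree_closed_UN: "(\<And>i. i \<in> I \<Longrightarrow> subtree_closed (T i)) \<Longrightarrow> subtree_closed (\<Union>i\<in>I. T i)"
  unfolding subtree_closed_def by blast

lemma subtree_closed_insert_Node:
  "subtree_closed T \<Longrightarrow> set (w # ws) \<subseteq> T \<Longrightarrow> subtree_closed (insert (Node w ws t) T)"
  unfolding subtree_closed_def by auto

lemma subtree_closed_map: "subtree_closed T \<Longrightarrow> subtree_closed (map_tree f ` T)"
  unfolding subtree_closed_def
proof (intro allI impI)
  fix w ws t
  assume T: "\<forall>w ws t. Node w ws t \<in> T \<longrightarrow> set (w # ws) \<subseteq> T" and "Node w ws t \<in> map_tree f ` T"
  then obtain v where "v \<in> T" "Node w ws t = map_tree f v" by blast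
  moreover then obtain u us where "v = Node u us t" "w = map_tree f u" "ws = map (map_tree f) us"
    by (cases v) auto
  moreover have "set (u # us) \<subseteq> T" using T calculation by blast
  ultimately show "set (w # ws) \<subseteq> map_tree f ` T" by auto
qed

lemma finite_subtree_closed_hull:
  fixes w :: "'u tree"
  obtains T where "finite T" "subtree_closed T" "w \<in> T" "T \<subseteq> trees_over (set_tree w)"
proof -
  have "\<exists>T. finite T \<and> subtree_closed T \<and> w \<in> T \<and> T \<subseteq> trees_over (set_tree w)"
  proof (induction w)
    case (Leaf a)
    show ?case by (rule exI[of _ "{Leaf a}"]) (auto simp: subtree_closed_def)
  next
    case (Node w ws t)
    then have "\<forall>v\<in>set (w # ws). \<exists>T. finite T \<and> subtree_closed T \<and> v \<in> T \<and> T \<subseteq> trees_over (set_tree v)"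
      by auto
    then obtain T where T: "\<And>v. v \<in> set (w # ws) \<Longrightarrow>
        finite (T v) \<and> subtree_closed (T v) \<and> v \<in> T v \<and> T v \<subseteq> trees_over (set_tree v)"
      by metis
    let ?U = "\<Union>v\<in>set (w # ws). T v"
    have "set (w # ws) \<subseteq> ?U" using T by blast
    then have "subtree_closed (insert (Node w ws t) ?U)"
      using T by (intro subtree_closed_insert_Node subtree_closed_UN) auto
    moreover have "finite ?U" using T by blast
    moreover have "?U \<subseteq> trees_over (set_tree (Node w ws t))"
    proof
      fix u assume "u \<in> ?U"
      then obtain v where v: "v \<in> set (w # ws)" "u \<in> T v" by blast
      then have "set_tree u \<subseteq> set_tree v" using T by blast
      also have "\<dots> \<subseteq> set_tree (Node w ws t)" using v(1) by auto
      finally show "u \<in> trees_over (set_tree (Node w ws t))" by simp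
    qed
    ultimately show ?case by (intro exI[of _ "insert (Node w ws t) ?U"]) auto
  qed
  then show thesis using that by blast
qed

text \<open>Polish notation; recording the number of subtrees makes it uniquely readable.\<close>

primrec tree_word :: "'u tree \<Rightarrow> ('u + nat) list" where
  "tree_word (Leaf a) = [Inl a]"
| "tree_word (Node w ws t) =
     Inr t # Inr (length ws) # tree_word w @ concat (map tree_word ws)"

text \<open>Unique readability in the form that induction requires: the word of a node is read
  subtree by subtree, so each induction hypothesis has to apply in front of an arbitrary rest of the
  word. The entry for the number of further subtrees ensures that the two lists of subtrees have
  equal length.\<close>

lemma tree_word_append_inject:
  "tree_word v @ xs = tree_word w @ ys \<longleftrightarrow> v = w \<and> xs = ys"
proof (induction v arbitrary: w xs ys)
  case (Leaf a)
  then show ?case by (cases w) auto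
next
  case (Node v vs t)
  have aux: "length vs = length ws \<Longrightarrow>
      concat (map tree_word vs) @ xs = concat (map tree_word ws) @ ys \<longleftrightarrow> vs = ws \<and> xs = ys" for ws xs ys
    using Node.IH(2)
  proof (induction vs arbitrary: ws xs ys)
    case Nil
    then show ?case by simp
  next
    case (Cons u us)
    then obtain z zs where ws: "ws = z # zs" by (cases ws) auto
    have "tree_word u @ xs = tree_word z @ ys \<longleftrightarrow> u = z \<and> xs = ys" for xs ys
      by (rule Cons.prems(2)) simp
    moreover have "concat (map tree_word us) @ xs = concat (map tree_word zs) @ ys \<longleftrightarrow> us = zs \<and> xs = ys"
      using Cons.prems ws by (intro Cons.IH) auto
    ultimately show ?case using ws by auto
  qed
  show ?case
  proof (cases w)
    case (Leaf b)
    then show ?thesis by simp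
  next
    case (Node w' ws s)
    then show ?thesis
      using Node.IH(1) aux by (auto simp: append_assoc)
  qed
qed

lemma inj_tree_word: "inj tree_word"
  by (metis injI append_Nil2 tree_word_append_inject)

lemma set_tree_word: "set (tree_word w) \<subseteq> set_tree w <+> UNIV"
proof (induction w)
  case (Node w ws t)
  then show ?case by (simp add: subset_iff) blast
qed auto

lemma tree_word_in_lists: "w \<in> trees_over S \<Longrightarrow> tree_word w \<in> lists (S <+> UNIV)"
  using set_tree_word[of w] by (fastforce simp: in_lists_conv_set)

lemma tree_word_map: "tree_word (map_tree f w) = map (map_sum f id) (tree_word w)"
  by (induction w) (auto simp: map_concat intro!: arg_cong[where f=concat])

lemma countable_trees_over:
  assumes "countable S" shows "countable (trees_over S)"
proof (rule countable_image_inj_on)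
  have "tree_word ` trees_over S \<subseteq> lists (S <+> UNIV)"
    using tree_word_in_lists by blast
  moreover have "countable (lists (S <+> (UNIV :: nat set)))"
    using assms by (intro countable_lists countable_Plus) auto
  ultimately show "countable (tree_word ` trees_over S)"
    by (rule countable_subset)
  show "inj_on tree_word (trees_over S)"
    using inj_tree_word by (rule inj_on_subset) simp
qed

section \<open>The order of trees induced by an order of labels\<close>

text \<open>Labels are compared by \<open>r\<close>; type codes and numbers of subtrees, which
  relabelling does not change, are compared as numbers. That labels precede numbers is a
  convention.\<close>

definition token_order :: "('u \<times> 'u) set \<Rightarrow> (('u + nat) \<times> ('u + nat)) set" where
  "token_order r = {(x, y). case (x, y) of
     (Inl a, Inl b) \<Rightarrow> (a, b) \<in> r | (Inl a, Inr n) \<Rightarrow> True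
   | (Inr m, Inl b) \<Rightarrow> False | (Inr m, Inr n) \<Rightarrow> m < n}"

text \<open>Comparing lengths before entries makes leaves precede nodes and subtrees precede the
  trees that contain them, whatever \<open>r\<close> is.\<close>

definition tree_order :: "('u \<times> 'u) set \<Rightarrow> ('u tree \<times> 'u tree) set" where
  "tree_order r = inv_image (lenlex (token_order r)) tree_word"

lemma trans_tree_order:
  assumes "trans r" shows "trans (tree_order r)"
proof -
  have "trans (token_order r)"
  proof (rule transI)
    fix x y z
    assume "(x, y) \<in> token_order r" "(y, z) \<in> token_order r"
    then show "(x, z) \<in> token_order r"
      by (cases x; cases y; cases z) (auto simp: token_order_def dest: transD[OF assms])
  qed
  then show ?thesis unfolding tree_order_def by (intro trans_inv_image lenlex_transI)
qed

lemma irrefl_tree_order: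
  assumes "irrefl r" shows "(w, w) \<notin> tree_order r"
  unfolding tree_order_def in_inv_image
proof (rule lenlex_irreflexive)
  show "(x, x) \<notin> token_order r" for x
    using assms by (cases x) (auto simp: token_order_def irrefl_def)
qed

lemma total_on_lenlex_lists:
  assumes "total_on S r" shows "total_on (lists S) (lenlex r)"
proof (rule total_onI)
  fix xs ys
  assume "xs \<in> lists S" "ys \<in> lists S" "xs \<noteq> ys"
  then show "(xs, ys) \<in> lenlex r \<or> (ys, xs) \<in> lenlex r"
  proof (induction xs arbitrary: ys rule: list.induct)
    case Nil
    then show ?case by simp
  next
    case (Cons x xs)
    show ?case
    proof (cases ys)
      case Nil
      then show ?thesis by simp
    next
      case ys: (Cons y ys')
      have "x = y \<or> (x, y) \<in> r \<or> (y, x) \<in> r"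
        using Cons.prems ys assms by (auto simp: total_on_def)
      moreover have "(xs, ys') \<in> lenlex r \<or> (ys', xs) \<in> lenlex r \<or> xs = ys'"
        using Cons.IH[of ys'] Cons.prems ys by auto
      ultimately show ?thesis
        using ys Cons.prems(3) by (auto simp: Cons_lenlex_iff)
    qed
  qed
qed

lemma total_on_tree_order:
  assumes "total_on S r" shows "total_on (trees_over S) (tree_order r)"
proof (rule total_onI)
  fix v w
  assume vw: "v \<in> trees_over S" "w \<in> trees_over S" "v \<noteq> w"
  have "total_on (S <+> UNIV) (token_order r)"
  proof (rule total_onI)
    fix x y
    assume "x \<in> S <+> (UNIV :: nat set)" "y \<in> S <+> (UNIV :: nat set)" "x \<noteq> y"
    then show "(x, y) \<in> token_order r \<or> (y, x) \<in> token_order r"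
      using assms by (elim PlusE) (auto simp: token_order_def total_on_def)
  qed
  then have "total_on (lists (S <+> UNIV)) (lenlex (token_order r))"
    by (rule total_on_lenlex_lists)
  moreover have "tree_word v \<noteq> tree_word w"
    using vw(3) by (simp add: inj_eq[OF inj_tree_word])
  ultimately have "(tree_word v, tree_word w) \<in> lenlex (token_order r) \<or>
      (tree_word w, tree_word v) \<in> lenlex (token_order r)"
    using tree_word_in_lists[OF vw(1)] tree_word_in_lists[OF vw(2)] unfolding total_on_def by blast
  then show "(v, w) \<in> tree_order r \<or> (w, v) \<in> tree_order r"
    by (simp add: tree_order_def)
qed

lemma lenlex_map_iff:
  assumes "inj_on h S" "\<And>x y. x \<in> S \<Longrightarrow> y \<in> S \<Longrightarrow> (h x, h y) \<in> r' \<longleftrightarrow> (x, y) \<in> r"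
    and "xs \<in> lists S" "ys \<in> lists S"
  shows "(map h xs, map h ys) \<in> lenlex r' \<longleftrightarrow> (xs, ys) \<in> lenlex r"
  using assms(3,4)
proof (induction xs arbitrary: ys rule: list.induct)
  case Nil
  then show ?case by simp
next
  case (Cons x xs)
  show ?case
  proof (cases ys)
    case Nil
    then show ?thesis by simp
  next
    case ys: (Cons y ys')
    then have "h x = h y \<longleftrightarrow> x = y" "(h x, h y) \<in> r' \<longleftrightarrow> (x, y) \<in> r"
      "(map h xs, map h ys') \<in> lenlex r' \<longleftrightarrow> (xs, ys') \<in> lenlex r"
      using Cons.prems Cons.IH assms(1,2) by (auto simp: inj_on_eq_iff)
    then show ?thesis using ys by (simp add: Cons_lenlex_iff)
  qed
qed

text \<open>Relabelling along an order embedding takes the trees below a node to trees below its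
  image, so that node conditions over different structures can be compared.\<close>

lemma tree_order_map_iff:
  assumes "inj_on f S" "\<And>x y. x \<in> S \<Longrightarrow> y \<in> S \<Longrightarrow> (f x, f y) \<in> r' \<longleftrightarrow> (x, y) \<in> r"
    and "v \<in> trees_over S" "w \<in> trees_over S"
  shows "(map_tree f v, map_tree f w) \<in> tree_order r' \<longleftrightarrow> (v, w) \<in> tree_order r"
  unfolding tree_order_def in_inv_image tree_word_map
proof (rule lenlex_map_iff[where S = "S <+> UNIV"])
  show "inj_on (map_sum f id) (S <+> UNIV)"
    by (rule inj_onI) (auto dest: inj_onD[OF assms(1)])
  show "(map_sum f id x, map_sum f id y) \<in> token_order r' \<longleftrightarrow> (x, y) \<in> token_order r"
    if "x \<in> S <+> UNIV" "y \<in> S <+> UNIV" for x y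
    using that by (elim PlusE) (simp_all add: token_order_def assms(2))
  show "tree_word v \<in> lists (S <+> UNIV)" by (rule tree_word_in_lists[OF assms(3)])
  show "tree_word w \<in> lists (S <+> UNIV)" by (rule tree_word_in_lists[OF assms(4)])
qed

lemma tree_order_length: "length (tree_word v) < length (tree_word w) \<Longrightarrow> (v, w) \<in> tree_order r"
  by (simp add: tree_order_def lenlex_conv)

lemma Leaf_less_Node: "(Leaf a, Node w ws t) \<in> tree_order r"
  by (rule tree_order_length) simp

lemma subtree_less_Node:
  assumes "v \<in> set (w # ws)" shows "(v, Node w ws t) \<in> tree_order r"
proof (rule tree_order_length)
  have "length (tree_word v) \<le> length (concat (map tree_word (w # ws)))"
    using assms unfolding length_concat by (intro member_le_sum_list) auto
  then show "length (tree_word v) < length (tree_word (Node w ws t))" by simp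
qed

text \<open>The induction removes the greatest tree of \<open>T\<close>. If it is a leaf, then
  \<open>T\<close> contains no nodes, since leaves precede nodes. If it is a node, then no tree of
  \<open>T\<close> has it as a child, because that tree would be greater; so the remainder is still
  subtree-closed. All leaves together form the base case because their values are prescribed
  jointly.\<close>

lemma finite_subtree_closed_induct [consumes 5, case_names leaves node]:
  assumes "finite T" "subtree_closed T" "trans r" "irrefl r" "total_on T (tree_order r)"
    and leaves: "\<And>T. finite T \<Longrightarrow> T \<subseteq> range Leaf \<Longrightarrow> P T"
    and node: "\<And>T w ws t. finite T \<Longrightarrow> subtree_closed T \<Longrightarrow> Node w ws t \<notin> T \<Longrightarrow> set (w # ws) \<subseteq> T \<Longrightarrow>
      \<forall>v\<in>T. (v, Node w ws t) \<in> tree_order r \<and> (Node w ws t, v) \<notin> tree_order r \<Longrightarrow>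
      P T \<Longrightarrow> P (insert (Node w ws t) T)"
  shows "P T"
  using assms(1,2,5)
proof (induction "card T" arbitrary: T)
  case 0
  then show ?case using leaves[of T] by auto
next
  case (Suc n T)
  let ?R = "tree_order r"
  have trans: "trans ?R" and irrefl: "\<And>w. (w, w) \<notin> ?R"
    using assms(3,4) by (simp_all add: trans_tree_order irrefl_tree_order)
  have "T \<noteq> {}" using Suc.hyps(2) by auto
  have "\<exists>m\<in>T. \<forall>v\<in>T - {m}. (v, m) \<in> ?R"
    using Suc.prems(1) \<open>T \<noteq> {}\<close> Suc.prems(3)
  proof (induction T rule: finite_ne_induct)
    case (singleton x)
    then show ?case by simp
  next
    case (insert x F)
    then obtain m where m: "m \<in> F" "\<forall>v\<in>F - {m}. (v, m) \<in> ?R"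
      by (auto simp: total_on_def)
    show ?case
    proof (cases "(x, m) \<in> ?R")
      case True
      then show ?thesis using m by (intro bexI[of _ m]) auto
    next
      case False
      then have "(m, x) \<in> ?R"
        using insert.prems insert.hyps m(1) by (auto simp: total_on_def)
      then have "\<forall>v\<in>F. (v, x) \<in> ?R" using m(2) transD[OF trans] by blast
      then show ?thesis by (intro bexI[of _ x]) auto
    qed
  qed
  then obtain m where m: "m \<in> T" "\<forall>v\<in>T - {m}. (v, m) \<in> ?R" by blast
  have not_above: "(m, v) \<notin> ?R" if "v \<in> T - {m}" for v
    using m(2) that transD[OF trans] irrefl by blast
  show ?case
  proof (cases m)
    case (Leaf a)
    have "T \<subseteq> range Leaf"
    proof
      fix v assume "v \<in> T"
      then show "v \<in> range Leaf"
        using Leaf not_above[of v] by (cases v) (auto simp: Leaf_less_Node)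
    qed
    then show ?thesis using leaves Suc.prems(1) by blast
  next
    case (Node w ws t)
    let ?U = "T - {Node w ws t}"
    have "subtree_closed ?U"
      unfolding subtree_closed_def
    proof (intro allI impI)
      fix v vs s
      assume *: "Node v vs s \<in> ?U"
      then have "set (v # vs) \<subseteq> T" using Suc.prems(2) subtree_closedD by blast
      moreover have "Node w ws t \<notin> set (v # vs)"
        using subtree_less_Node[of "Node w ws t" v vs s r] not_above[of "Node v vs s"] * Node by blast
      ultimately show "set (v # vs) \<subseteq> ?U" by blast
    qed
    moreover have "n = card ?U" using Suc.hyps(2) Suc.prems(1) m(1) Node by simp
    moreover have "total_on ?U ?R" using Suc.prems(3) by (auto simp: total_on_def)
    ultimately have "P ?U" using Suc.hyps(1) Suc.prems(1) by blast
    moreover have "set (w # ws) \<subseteq> ?U"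
      using subtree_closedD[OF Suc.prems(2), of w ws t] m(1) Node irrefl
        subtree_less_Node[of "Node w ws t" w ws t r] by blast
    ultimately have "P (insert (Node w ws t) ?U)"
      using \<open>subtree_closed ?U\<close> Suc.prems(1) m(2) not_above Node by (intro node) auto
    then show ?thesis using m(1) Node by (simp add: insert_absorb)
  qed
qed


section \<open>Free assignments\<close>

text \<open>
  \<open>C\<close> is the carrier of \<open>M\<close>, \<open>G\<close> its automorphism group, \<open>J b A D\<close> says that \<open>b\<close> is independent
  from the finite set \<open>D\<close> over the finite non-empty set \<open>A\<close>, and \<open>tuple_of\<close> enumerates the finite
  tuples.
\<close>

locale pointwise_independence =
  fixes C :: "'a set" and G :: "('a \<Rightarrow> 'a) set" and J :: "'a \<Rightarrow> 'a set \<Rightarrow> 'a set \<Rightarrow> bool"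
    and tuple_of :: "nat \<Rightarrow> 'a list"
  assumes countable_C: "countable C"
    and G_closed: "g \<in> G \<Longrightarrow> x \<in> C \<Longrightarrow> g x \<in> C"
    and G_id: "id \<in> G"
    and G_comp: "g \<in> G \<Longrightarrow> h \<in> G \<Longrightarrow> g \<circ> h \<in> G"
    and G_inv: "g \<in> G \<Longrightarrow> \<exists>h\<in>G. \<forall>x\<in>C. h (g x) = x \<and> g (h x) = x"
    and range_tuple_of: "range tuple_of = lists C"
    and J_invariant: "g \<in> G \<Longrightarrow> b \<in> C \<Longrightarrow> finite A \<Longrightarrow> A \<noteq> {} \<Longrightarrow> A \<subseteq> C \<Longrightarrow> finite D \<Longrightarrow> D \<subseteq> C \<Longrightarrow>
      J b A D \<Longrightarrow> J (g b) (g ` A) (g ` D)"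
    and J_exists: "b \<in> C \<Longrightarrow> finite A \<Longrightarrow> A \<noteq> {} \<Longrightarrow> A \<subseteq> C \<Longrightarrow> finite D \<Longrightarrow> D \<subseteq> C \<Longrightarrow>
      \<exists>g\<in>G. (\<forall>x\<in>A. g x = x) \<and> J (g b) A D"
    and J_stationary: "b \<in> C \<Longrightarrow> finite A \<Longrightarrow> A \<noteq> {} \<Longrightarrow> A \<subseteq> C \<Longrightarrow> finite D \<Longrightarrow> D \<subseteq> C \<Longrightarrow>
      h \<in> G \<Longrightarrow> \<forall>x\<in>A. h x = x \<Longrightarrow> J b A D \<Longrightarrow> J (h b) A D \<Longrightarrow>
      \<exists>g\<in>G. (\<forall>x\<in>D. g x = x) \<and> g b = h b"
    and J_mono: "b \<in> C \<Longrightarrow> finite A \<Longrightarrow> A \<noteq> {} \<Longrightarrow> A \<subseteq> C \<Longrightarrow> finite D \<Longrightarrow> D \<subseteq> C \<Longrightarrow> D' \<subseteq> D \<Longrightarrow>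
      J b A D \<Longrightarrow> J b A D'"
begin

section \<open>Conjugacy of tuples\<close>

text \<open>For the automorphism group of an ultrahomogeneous structure, finite tuples are conjugate
  exactly if they have the same quantifier-free type. Conjugacy thus serves as equality of types
  without any syntax.\<close>

definition conjugate_lists :: "'a list \<Rightarrow> 'a list \<Rightarrow> bool" where
  "conjugate_lists xs ys \<longleftrightarrow> (\<exists>g\<in>G. map g xs = ys)"

lemma conjugate_lists_sym:
  assumes "conjugate_lists xs ys" "set xs \<subseteq> C" shows "conjugate_lists ys xs"
proof -
  obtain g where g: "g \<in> G" "map g xs = ys" using assms(1) unfolding conjugate_lists_def by blast
  then obtain h where h: "h \<in> G" "\<forall>x\<in>C. h (g x) = x" using G_inv by blast
  have "map h ys = xs" using g(2) h(2) assms(2) by (auto simp: subset_iff intro!: map_idI)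
  then show ?thesis using h(1) unfolding conjugate_lists_def by blast
qed

lemma conjugate_lists_trans:
  assumes "conjugate_lists xs ys" "conjugate_lists ys zs" shows "conjugate_lists xs zs"
proof -
  obtain g h where gh: "g \<in> G" "map g xs = ys" "h \<in> G" "map h ys = zs"
    using assms unfolding conjugate_lists_def by blast
  then have "map (h \<circ> g) xs = zs" by auto
  then show ?thesis using G_comp[OF gh(3,1)] unfolding conjugate_lists_def by blast
qed

lemma conjugate_lists_mapI: "g \<in> G \<Longrightarrow> conjugate_lists xs (map g xs)"
  unfolding conjugate_lists_def by blast

lemma conjugate_lists_map_iff:
  assumes "g \<in> G" "set ys \<subseteq> C"
  shows "conjugate_lists xs (map g ys) \<longleftrightarrow> conjugate_lists xs ys"
  using conjugate_lists_mapI[OF assms(1), of ys] conjugate_lists_sym[OF _ assms(2)]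
    conjugate_lists_trans by blast

text \<open>
  A node \<open>Node w ws t\<close> prescribes a type over its subtrees: \<open>tuple_of t = b # as\<close> stands for the
  type of \<open>b\<close> over \<open>as\<close>, transported to the values of \<open>w # ws\<close> whenever these are conjugate to \<open>as\<close>.
  Otherwise the node repeats the value of \<open>w\<close>.
\<close>

definition node_condition ::
    "('u \<times> 'u) set \<Rightarrow> 'u tree set \<Rightarrow> ('u tree \<Rightarrow> 'a) \<Rightarrow> 'u tree \<Rightarrow> 'u tree list \<Rightarrow> nat \<Rightarrow> bool" where
  "node_condition r T e w ws t \<longleftrightarrow>
     (if conjugate_lists (tl (tuple_of t)) (map e (w # ws))
      then conjugate_lists (tuple_of t) (map e (Node w ws t # w # ws)) \<and>
           J (e (Node w ws t)) (e ` set (w # ws)) (e ` {v \<in> T. (v, Node w ws t) \<in> tree_order r})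
      else e (Node w ws t) = e w)"

text \<open>The labelling \<open>\<eta>\<close> is realised only up to an element of
  \<open>G\<close>, which may depend on \<open>T\<close>. This makes freeness invariant under
  \<open>G\<close> and leaves room for moving a whole assignment.\<close>

definition free_on :: "('u \<Rightarrow> 'a) \<Rightarrow> ('u \<times> 'u) set \<Rightarrow> 'u tree set \<Rightarrow> ('u tree \<Rightarrow> 'a) \<Rightarrow> bool" where
  "free_on \<eta> r T e \<longleftrightarrow> e ` T \<subseteq> C \<and>
     (\<exists>g\<in>G. \<forall>a. Leaf a \<in> T \<longrightarrow> e (Leaf a) = g (\<eta> a)) \<and>
     (\<forall>w ws t. Node w ws t \<in> T \<longrightarrow> node_condition r T e w ws t)"

lemma free_onD:
  assumes "free_on \<eta> r T e"
  shows "e ` T \<subseteq> C" "\<exists>g\<in>G. \<forall>a. Leaf a \<in> T \<longrightarrow> e (Leaf a) = g (\<eta> a)"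
    "Node w ws t \<in> T \<Longrightarrow> node_condition r T e w ws t"
  using assms unfolding free_on_def by auto

section \<open>Restriction and conjugation of free assignments\<close>

lemma node_condition_cong:
  assumes "\<And>v. v \<in> insert (Node w ws t) (set (w # ws)) \<Longrightarrow> e v = e' v"
    and "\<And>v. v \<in> T \<Longrightarrow> (v, Node w ws t) \<in> tree_order r \<Longrightarrow> e v = e' v"
  shows "node_condition r T e w ws t \<longleftrightarrow> node_condition r T e' w ws t"
proof -
  have "map e ws = map e' ws" "e (Node w ws t) = e' (Node w ws t)" "e w = e' w"
    using assms(1) by auto
  moreover have "e ` set (w # ws) = e' ` set (w # ws)" using assms(1) by (intro image_cong) auto
  moreover have "e ` {v \<in> T. (v, Node w ws t) \<in> tree_order r} = e' ` {v \<in> T. (v, Node w ws t) \<in> tree_order r}"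
    using assms(2) by (intro image_cong) auto
  ultimately show ?thesis unfolding node_condition_def list.map by (simp only:)
qed

lemma free_on_cong:
  assumes "free_on \<eta> r T e" "subtree_closed T" "\<And>v. v \<in> T \<Longrightarrow> e v = e' v"
  shows "free_on \<eta> r T e'"
proof -
  have "node_condition r T e' w ws t" if "Node w ws t \<in> T" for w ws t
  proof -
    have "node_condition r T e w ws t \<longleftrightarrow> node_condition r T e' w ws t"
      using that subtree_closedD[OF assms(2) that] assms(3) by (intro node_condition_cong) auto
    then show ?thesis using free_onD(3)[OF assms(1) that] by blast
  qed
  moreover have "e' ` T \<subseteq> C" using free_onD(1)[OF assms(1)] assms(3) by force
  moreover have "\<exists>g\<in>G. \<forall>a. Leaf a \<in> T \<longrightarrow> e' (Leaf a) = g (\<eta> a)"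
    using free_onD(2)[OF assms(1)] assms(3) by fastforce
  ultimately show ?thesis unfolding free_on_def by blast
qed

text \<open>Passing to a smaller set shrinks the set of trees below each node, and independence is
  monotone in that argument.\<close>

lemma free_on_subset:
  assumes "free_on \<eta> r T e" "finite T" "T' \<subseteq> T" "subtree_closed T'"
  shows "free_on \<eta> r T' e"
proof -
  have "node_condition r T' e w ws t" if "Node w ws t \<in> T'" for w ws t
  proof -
    have N: "node_condition r T e w ws t" using free_onD(3)[OF assms(1)] that assms(3) by blast
    have sub: "set (w # ws) \<subseteq> T" using subtree_closedD[OF assms(4) that] assms(3) by blast
    have "J (e (Node w ws t)) (e ` set (w # ws)) (e ` {v \<in> T'. (v, Node w ws t) \<in> tree_order r})"
      if "J (e (Node w ws t)) (e ` set (w # ws)) (e ` {v \<in> T. (v, Node w ws t) \<in> tree_order r})"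
    proof (rule J_mono[OF _ _ _ _ _ _ _ that])
      show "e (Node w ws t) \<in> C" using \<open>Node w ws t \<in> T'\<close> assms(3) free_onD(1)[OF assms(1)] by blast
      show "e ` set (w # ws) \<subseteq> C" using sub free_onD(1)[OF assms(1)] by blast
      show "e ` {v \<in> T. (v, Node w ws t) \<in> tree_order r} \<subseteq> C" using free_onD(1)[OF assms(1)] by blast
      show "finite (e ` {v \<in> T. (v, Node w ws t) \<in> tree_order r})" using assms(2) by simp
    qed (use assms(3) in auto)
    then show ?thesis using N unfolding node_condition_def by (simp split: if_splits)
  qed
  moreover have "e ` T' \<subseteq> C" using free_onD(1)[OF assms(1)] assms(3) by blast
  moreover have "\<exists>g\<in>G. \<forall>a. Leaf a \<in> T' \<longrightarrow> e (Leaf a) = g (\<eta> a)"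
    using free_onD(2)[OF assms(1)] assms(3) by blast
  ultimately show ?thesis unfolding free_on_def by blast
qed

text \<open>Both ingredients of a node condition are invariant under \<open>G\<close>: conjugacy of
  lists because \<open>G\<close> is a group of bijections of \<open>C\<close>, independence by
  \<open>J_invariant\<close>.\<close>

lemma free_on_conjugate:
  assumes "free_on \<eta> r T e" "finite T" "subtree_closed T" "g \<in> G"
  shows "free_on \<eta> r T (g \<circ> e)"
proof -
  have "node_condition r T (g \<circ> e) w ws t" if T: "Node w ws t \<in> T" for w ws t
  proof -
    have N: "node_condition r T e w ws t" using free_onD(3)[OF assms(1) T] .
    have sub: "e ` set (w # ws) \<subseteq> C" "e (Node w ws t) \<in> C"
      using subtree_closedD[OF assms(3) T] T free_onD(1)[OF assms(1)] by blast+
    have "conjugate_lists xs (map (g \<circ> e) us) \<longleftrightarrow> conjugate_lists xs (map e us)"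
      if "e ` set us \<subseteq> C" for xs us
      using conjugate_lists_map_iff[OF assms(4), of "map e us" xs] that by simp
    then have conj: "conjugate_lists xs (map (g \<circ> e) (w # ws)) \<longleftrightarrow> conjugate_lists xs (map e (w # ws))"
      "conjugate_lists xs (map (g \<circ> e) (Node w ws t # w # ws)) \<longleftrightarrow>
        conjugate_lists xs (map e (Node w ws t # w # ws))" for xs
      using sub by (metis, metis insert_subset image_insert list.simps(15))
    have "J (g (e (Node w ws t))) (g ` e ` set (w # ws)) (g ` e ` {v \<in> T. (v, Node w ws t) \<in> tree_order r})"
      if "J (e (Node w ws t)) (e ` set (w # ws)) (e ` {v \<in> T. (v, Node w ws t) \<in> tree_order r})"
      using free_onD(1)[OF assms(1)] assms(2) sub
      by (intro J_invariant that assms(4)) auto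
    then show ?thesis
      using N unfolding node_condition_def conj by (simp add: image_comp split: if_splits)
  qed
  moreover have "(g \<circ> e) ` T \<subseteq> C" using free_onD(1)[OF assms(1)] G_closed[OF assms(4)] by auto
  moreover obtain h where "h \<in> G" "\<forall>a. Leaf a \<in> T \<longrightarrow> e (Leaf a) = h (\<eta> a)"
    using free_onD(2)[OF assms(1)] by blast
  then have "\<exists>h\<in>G. \<forall>a. Leaf a \<in> T \<longrightarrow> (g \<circ> e) (Leaf a) = h (\<eta> a)"
    using G_comp[OF assms(4)] by (intro bexI[of _ "g \<circ> h"]) auto
  ultimately show ?thesis unfolding free_on_def by blast
qed

section \<open>Uniqueness, existence and extension on finite sets\<close>

text \<open>The greatest node has all other trees below it. Once one assignment has been moved so
  that both agree on those trees, the two values of the node have the same type over the children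
  and are both independent from the rest; stationarity then joins them by an element of
  \<open>G\<close> that fixes the rest.\<close>

lemma free_on_unique:
  fixes T :: "'u tree set"
  assumes "finite T" "subtree_closed T" "trans r" "irrefl r" "total_on T (tree_order r)"
    and "free_on \<eta> r T e" "free_on \<eta> r T e'" "\<And>a. Leaf a \<in> T \<Longrightarrow> \<eta> a \<in> C"
  shows "\<exists>g\<in>G. \<forall>v\<in>T. e' v = g (e v)"
  using assms
proof (induction T rule: finite_subtree_closed_induct)
  case (leaves T)
  obtain g g' where g: "g \<in> G" "\<forall>a. Leaf a \<in> T \<longrightarrow> e (Leaf a) = g (\<eta> a)"
    and g': "g' \<in> G" "\<forall>a. Leaf a \<in> T \<longrightarrow> e' (Leaf a) = g' (\<eta> a)"
    using free_onD(2)[OF leaves.prems(1)] free_onD(2)[OF leaves.prems(2)] by blast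
  obtain h where h: "h \<in> G" "\<forall>x\<in>C. h (g x) = x" using G_inv[OF g(1)] by blast
  have "\<forall>v\<in>T. e' v = (g' \<circ> h) (e v)"
    using leaves.hyps(2) leaves.prems(3) g(2) g'(2) h(2) by fastforce
  then show ?case using G_comp[OF g'(1) h(1)] by blast
next
  case (node T w ws t)
  let ?N = "Node w ws t"
  let ?T' = "insert ?N T"
  have cl: "subtree_closed ?T'" and fin: "finite ?T'"
    using node.hyps(1) subtree_closed_insert_Node[OF node.hyps(2,4)] by auto
  have "\<exists>g\<in>G. \<forall>v\<in>T. e' v = g (e v)"
    using node.prems node.hyps(1,2) fin by (intro node.IH) (blast intro: free_on_subset)+
  then obtain g where g: "g \<in> G" "\<forall>v\<in>T. e' v = g (e v)" by blast
  define f where "f = g \<circ> e"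
  have f: "free_on \<eta> r ?T' f"
    unfolding f_def using node.prems(1) fin cl g(1) by (rule free_on_conjugate)
  have eq: "f v = e' v" if "v \<in> T" for v using g(2) that by (simp add: f_def)
  have base: "map f (w # ws) = map e' (w # ws)" using eq node.hyps(4) by auto
  have below: "{v \<in> ?T'. (v, ?N) \<in> tree_order r} = T"
    using node.hyps(3,5) irrefl_tree_order[OF assms(4)] by auto
  have C: "f ` ?T' \<subseteq> C" "e' ` ?T' \<subseteq> C" using free_onD(1) f node.prems(2) by blast+
  have "\<exists>k\<in>G. (\<forall>x\<in>f ` T. k x = x) \<and> k (f ?N) = e' ?N"
  proof (cases "conjugate_lists (tl (tuple_of t)) (map e' (w # ws))")
    \<comment> \<open>The children do not have the type that the node asks for, so both assignments
      repeat the value of the first child, where they agree already.\<close>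
    case False
    then have "f ?N = f w" "e' ?N = e' w"
      using free_onD(3)[OF f, of w ws t] free_onD(3)[OF node.prems(2), of w ws t]
      unfolding node_condition_def base by simp_all
    then have "f ?N = e' ?N" using eq node.hyps(4) by simp
    then show ?thesis using G_id by (intro bexI[of _ id]) auto
  next
    case True
    have nf: "conjugate_lists (tuple_of t) (map f (?N # w # ws))" "J (f ?N) (f ` set (w # ws)) (f ` T)"
      using free_onD(3)[OF f, of w ws t] True unfolding node_condition_def below base by simp_all
    have "e' ` set (w # ws) = f ` set (w # ws)" "e' ` T = f ` T"
      using eq node.hyps(4) by (intro image_cong; auto)+
    then have ne: "conjugate_lists (tuple_of t) (map e' (?N # w # ws))" "J (e' ?N) (f ` set (w # ws)) (f ` T)"
      using free_onD(3)[OF node.prems(2), of w ws t] True unfolding node_condition_def below by simp_all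
    have "set (tuple_of t) \<subseteq> C" using range_tuple_of by (metis in_lists_conv_set rangeI subsetI)
    then have "conjugate_lists (map f (?N # w # ws)) (map e' (?N # w # ws))"
      using nf(1) ne(1) conjugate_lists_sym conjugate_lists_trans by blast
    \<comment> \<open>Both tuples are conjugate to \<open>tuple_of t\<close>, which yields
      \<open>h\<close>. It is known to fix the values of the children only; stationarity exchanges
      it for an element that fixes the values on all of \<open>T\<close>.\<close>
    then obtain h where h: "h \<in> G" "map h (map f (?N # w # ws)) = map e' (?N # w # ws)"
      unfolding conjugate_lists_def by blast
    have "h (f ?N) = e' ?N" using h(2) by simp
    moreover have "\<forall>x\<in>f ` set (w # ws). h x = x"
      using h(2) base by simp
    moreover have "f ` set (w # ws) \<subseteq> C" "f ` T \<subseteq> C" "f ?N \<in> C"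
      using C(1) node.hyps(4) by blast+
    ultimately have "\<exists>g\<in>G. (\<forall>x\<in>f ` T. g x = x) \<and> g (f ?N) = h (f ?N)"
      using nf(2) ne(2) h(1) node.hyps(1)
      by (intro J_stationary[where A = "f ` set (w # ws)"]) simp_all
    then show ?thesis using \<open>h (f ?N) = e' ?N\<close> by simp
  qed
  then obtain k where k: "k \<in> G" "\<forall>x\<in>f ` T. k x = x" "k (f ?N) = e' ?N" by blast
  then have "\<forall>v\<in>?T'. e' v = (k \<circ> g) (e v)" using eq unfolding f_def by auto
  then show ?case using G_comp[OF k(1) g(1)] by blast
qed

text \<open>A new greatest node does not affect the conditions of the older ones, since these refer
  only to the node itself and to trees below it. Its own value is found by transporting the
  prescribed type to the children and then moving the realisation into independent position.\<close>

lemma free_on_exists: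
  fixes T :: "'u tree set"
  assumes "finite T" "subtree_closed T" "trans r" "irrefl r" "total_on T (tree_order r)"
    and "\<And>a. Leaf a \<in> T \<Longrightarrow> \<eta> a \<in> C"
  shows "\<exists>e. free_on \<eta> r T e"
  using assms
proof (induction T rule: finite_subtree_closed_induct)
  case (leaves T)
  let ?e = "case_tree \<eta> (\<lambda>_ _ _. undefined)"
  have "?e ` T \<subseteq> C" using leaves.hyps(2) leaves.prems by fastforce
  moreover have "\<exists>g\<in>G. \<forall>a. Leaf a \<in> T \<longrightarrow> ?e (Leaf a) = g (\<eta> a)"
    using G_id by (intro bexI[of _ id]) auto
  ultimately have "free_on \<eta> r T ?e"
    unfolding free_on_def using leaves.hyps(2) by blast
  then show ?case by blast
next
  case (node T w ws t)
  let ?N = "Node w ws t"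
  obtain e where e: "free_on \<eta> r T e" using node.IH node.prems by blast
  have C: "e ` T \<subseteq> C" using free_onD(1)[OF e] .
  have below: "{v \<in> insert ?N T. (v, ?N) \<in> tree_order r} = T"
    using node.hyps(3,5) irrefl_tree_order[OF assms(4)] by auto
  have "\<exists>b\<in>C. node_condition r (insert ?N T) (e(?N := b)) w ws t"
  proof (cases "conjugate_lists (tl (tuple_of t)) (map e (w # ws))")
    case False
    have base: "map (e(?N := e w)) (w # ws) = map e (w # ws)" using node.hyps(3,4) by auto
    have "node_condition r (insert ?N T) (e(?N := e w)) w ws t"
      using False unfolding node_condition_def base by simp
    then show ?thesis using C node.hyps(4) by auto
  next
    case True
    then obtain k where k: "k \<in> G" "map k (tl (tuple_of t)) = map e (w # ws)"
      unfolding conjugate_lists_def by blast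
    \<comment> \<open>The code of the empty tuple does not pass the test, as
      \<open>tl [] = []\<close> is not conjugate to a non-empty list.\<close>
    then have ne: "tuple_of t \<noteq> []" by auto
    have "set (tuple_of t) \<subseteq> C" using range_tuple_of by (metis in_lists_conv_set rangeI subsetI)
    then have "k (hd (tuple_of t)) \<in> C" using ne G_closed[OF k(1)] hd_in_set by blast
    moreover have "e ` set (w # ws) \<subseteq> C" using C node.hyps(4) by blast
    \<comment> \<open>\<open>k\<close> takes the first entry of the tuple to a realisation of its
      type over the children. \<open>J_exists\<close> moves this realisation while fixing the
      children, so the type is kept.\<close>
    ultimately have "\<exists>g\<in>G. (\<forall>x\<in>e ` set (w # ws). g x = x) \<and>
        J (g (k (hd (tuple_of t)))) (e ` set (w # ws)) (e ` T)"
      using C node.hyps(1) by (intro J_exists) simp_all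
    then obtain g where g: "g \<in> G" "\<forall>x\<in>e ` set (w # ws). g x = x"
      "J (g (k (hd (tuple_of t)))) (e ` set (w # ws)) (e ` T)"
      by blast
    let ?b = "g (k (hd (tuple_of t)))"
    let ?e = "e(?N := ?b)"
    have same: "map ?e (w # ws) = map e (w # ws)" "?e ` set (w # ws) = e ` set (w # ws)" "?e ` T = e ` T"
      using node.hyps(3,4) by auto
    have "map (g \<circ> k) (tuple_of t) = ?b # map g (map e (w # ws))"
      using ne k(2) by (metis comp_apply list.exhaust_sel list.simps(9) map_map)
    also have "map g (map e (w # ws)) = map e (w # ws)" using g(2) by (intro map_idI) auto
    finally have "map (g \<circ> k) (tuple_of t) = ?b # map e (w # ws)" .
    then have "conjugate_lists (tuple_of t) (?b # map e (w # ws))"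
      using conjugate_lists_mapI[OF G_comp[OF g(1) k(1)]] by metis
    moreover have sameN: "map ?e (?N # w # ws) = ?b # map e (w # ws)" "?e ?N = ?b" using same(1) by simp_all
    ultimately have "node_condition r (insert ?N T) ?e w ws t"
      using True g(3) unfolding node_condition_def below sameN same by (simp only: if_True)
    then show ?thesis using \<open>k (hd (tuple_of t)) \<in> C\<close> G_closed[OF g(1)] by blast
  qed
  then obtain b where b: "b \<in> C" "node_condition r (insert ?N T) (e(?N := b)) w ws t" by blast
  let ?e = "e(?N := b)"
  have e': "free_on \<eta> r T ?e" using e node.hyps(2) by (rule free_on_cong) (use node.hyps(3) in auto)
  have "node_condition r (insert ?N T) ?e v vs s" if "Node v vs s \<in> T" for v vs s
  proof -
    have "{u \<in> insert ?N T. (u, Node v vs s) \<in> tree_order r} = {u \<in> T. (u, Node v vs s) \<in> tree_order r}"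
      using node.hyps(5) that by auto
    then show ?thesis using free_onD(3)[OF e' that] unfolding node_condition_def by (simp only:)
  qed
  then have "free_on \<eta> r (insert ?N T) ?e"
    using b free_onD(1,2)[OF e'] unfolding free_on_def by auto
  then show ?case by blast
qed

text \<open>Trees of \<open>T\<close> outside \<open>T'\<close> may lie below nodes of
  \<open>T'\<close>, so values for them cannot simply be added to \<open>e\<close> one by one.
  Instead, a fresh assignment on all of \<open>T\<close> is moved by the element of \<open>G\<close>
  that uniqueness on \<open>T'\<close> provides.\<close>

lemma free_on_extend:
  fixes T :: "'u tree set"
  assumes T: "finite T" "subtree_closed T" "trans r" "irrefl r" "total_on T (tree_order r)"
    and \<eta>: "\<And>a. Leaf a \<in> T \<Longrightarrow> \<eta> a \<in> C"
    and T': "T' \<subseteq> T" "subtree_closed T'" "free_on \<eta> r T' e"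
  shows "\<exists>e'. free_on \<eta> r T e' \<and> (\<forall>v\<in>T'. e' v = e v)"
proof -
  obtain f where f: "free_on \<eta> r T f" using free_on_exists[OF T, of \<eta>] \<eta> by blast
  have "finite T'" "total_on T' (tree_order r)"
    using T(1,5) T'(1) by (auto intro: finite_subset simp: total_on_def)
  moreover have "free_on \<eta> r T' f" using f T(1) T'(1,2) by (rule free_on_subset)
  ultimately obtain g where g: "g \<in> G" "\<forall>v\<in>T'. e v = g (f v)"
    using free_on_unique[of T' r \<eta> f e] T(3,4) T' \<eta> by blast
  have "free_on \<eta> r T (g \<circ> f)" using f T(1,2) g(1) by (rule free_on_conjugate)
  then show ?thesis using g(2) by auto
qed

section \<open>A free assignment onto the whole structure\<close>

text \<open>The added node has all of \<open>T\<close> as its children and codes the type of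
  \<open>m\<close> over their values. In any free extension of \<open>e\<close> its value is
  therefore conjugate to \<open>m\<close> over the values on \<open>T\<close>, and an element of
  \<open>G\<close> that fixes these moves it to \<open>m\<close>.\<close>

lemma free_on_hit:
  fixes T :: "'u tree set"
  assumes T: "finite T" "subtree_closed T" "T \<noteq> {}" "T \<subseteq> trees_over S"
    and r: "trans r" "irrefl r" "total_on S r"
    and \<eta>: "\<eta> ` S \<subseteq> C" and e: "free_on \<eta> r T e" and m: "m \<in> C"
  shows "\<exists>T' e'. T \<subseteq> T' \<and> T' \<subseteq> trees_over S \<and> finite T' \<and> subtree_closed T' \<and> free_on \<eta> r T' e' \<and>
    (\<forall>v\<in>T. e' v = e v) \<and> m \<in> e' ` T'"
proof -
  obtain us where "set us = T" using finite_list[OF T(1)] by blast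
  with T(3) obtain w ws where ws: "set (w # ws) = T" by (cases us) auto
  have C: "e ` T \<subseteq> C" using free_onD(1)[OF e] .
  then have "m # map e (w # ws) \<in> lists C" using m ws by auto
  then obtain t where t: "tuple_of t = m # map e (w # ws)"
    using range_tuple_of by (metis imageE)
  let ?N = "Node w ws t"
  let ?T = "insert ?N T"
  have NS: "?T \<subseteq> trees_over S" using T(4) ws by auto
  have tot: "total_on ?T (tree_order r)"
    using total_on_tree_order[OF r(3)] NS unfolding total_on_def by blast
  have fin: "finite ?T" and cl: "subtree_closed ?T"
    using T(1) subtree_closed_insert_Node[OF T(2)] ws by auto
  have "\<eta> a \<in> C" if "Leaf a \<in> ?T" for a using subsetD[OF NS that] \<eta> by auto
  then obtain f where f: "free_on \<eta> r ?T f" "\<forall>v\<in>T. f v = e v"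
    using free_on_extend[OF fin cl r(1,2) tot, of \<eta> T e] T(2) e by blast
  have base: "map f (w # ws) = map e (w # ws)" using f(2) ws by auto
  \<comment> \<open>The test of the node condition succeeds by the identity, because the code was
    made from the values of \<open>e\<close> themselves.\<close>
  have "conjugate_lists (tl (tuple_of t)) (map f (w # ws))"
    unfolding base t list.sel using conjugate_lists_mapI[OF G_id, of "map e (w # ws)"] by simp
  then have "conjugate_lists (tuple_of t) (map f (?N # w # ws))"
    using free_onD(3)[OF f(1), of w ws t] unfolding node_condition_def by simp
  moreover have "set (tuple_of t) \<subseteq> C" using range_tuple_of by (metis in_lists_conv_set rangeI subsetI)
  ultimately obtain g where g: "g \<in> G" "map g (map f (?N # w # ws)) = m # map e (w # ws)"
    using conjugate_lists_sym t unfolding conjugate_lists_def by metis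
  have "free_on \<eta> r ?T (g \<circ> f)" using f(1) fin cl g(1) by (rule free_on_conjugate)
  moreover have "\<forall>v\<in>T. (g \<circ> f) v = e v" using g(2) ws by auto
  moreover have "(g \<circ> f) ?N = m" using g(2) by simp
  ultimately show ?thesis using NS fin cl by (intro exI[of _ ?T] exI[of _ "g \<circ> f"]) auto
qed

text \<open>Dependent choice yields a chain of finite free assignments; stage \<open>n\<close> takes
  in the tree \<open>tr n\<close> with its subtrees and then makes \<open>el n\<close> a value.
  Every finite subtree-closed set lies in a single member of the chain, and so the limit is free on
  it.\<close>

lemma free_surjection_exists:
  fixes S :: "'u set"
  assumes S: "countable S" "S \<noteq> {}" and r: "trans r" "irrefl r" "total_on S r" and \<eta>: "\<eta> ` S \<subseteq> C"
  shows "\<exists>e. e ` trees_over S = C \<and>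
    (\<forall>T. finite T \<longrightarrow> subtree_closed T \<longrightarrow> T \<subseteq> trees_over S \<longrightarrow> free_on \<eta> r T e)"
proof -
  obtain a where a: "a \<in> S" using S(2) by blast
  then have neT: "trees_over S \<noteq> {}" by (auto intro!: exI[of _ "Leaf a"])
  have neC: "C \<noteq> {}" using a \<eta> by blast
  define tr where "tr = from_nat_into (trees_over S)"
  define el where "el = from_nat_into C"
  have tr: "range tr = trees_over S"
    unfolding tr_def using neT countable_trees_over[OF S(1)] by (rule range_from_nat_into)
  have el: "range el = C"
    unfolding el_def using neC countable_C by (rule range_from_nat_into)
  define good where "good = (\<lambda>(T, e). finite T \<and> subtree_closed T \<and> T \<noteq> {} \<and> T \<subseteq> trees_over S \<and> free_on \<eta> r T e)"
  define step where "step n = (\<lambda>(T, e) (T', e'). T \<subseteq> T' \<and> (\<forall>v\<in>T. e' v = e v) \<and> tr n \<in> T' \<and> el n \<in> e' ` T')"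
    for n and e e' :: "'u tree \<Rightarrow> 'a"
  have tot: "total_on T (tree_order r)" if "T \<subseteq> trees_over S" for T
    using total_on_tree_order[OF r(3)] that unfolding total_on_def by blast
  have \<eta>': "\<eta> a \<in> C" if "T \<subseteq> trees_over S" "Leaf a \<in> T" for T a using subsetD[OF that] \<eta> by auto
  have start: "\<exists>x. good x"
  proof -
    let ?T = "{Leaf a}"
    have T: "finite ?T" "subtree_closed ?T" "?T \<subseteq> trees_over S" using a by (auto simp: subtree_closed_def)
    then obtain e where "free_on \<eta> r ?T e"
      using free_on_exists[OF T(1,2) r(1,2) tot[OF T(3)], of \<eta>] \<eta>'[OF T(3)] by blast
    then show ?thesis using T by (intro exI[of _ "(?T, e)"]) (auto simp: good_def)
  qed
  have next_step: "\<exists>y. good y \<and> step n x y" if "good x" for x n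
  proof -
    obtain T e where x: "x = (T, e)" by fastforce
    have T: "finite T" "subtree_closed T" "T \<noteq> {}" "T \<subseteq> trees_over S" "free_on \<eta> r T e"
      using that unfolding good_def x by auto
    obtain U where U: "finite U" "subtree_closed U" "tr n \<in> U" "U \<subseteq> trees_over (set_tree (tr n))"
      by (rule finite_subtree_closed_hull)
    have "tr n \<in> trees_over S" using tr by blast
    then have TU: "finite (T \<union> U)" "subtree_closed (T \<union> U)" "T \<union> U \<subseteq> trees_over S" "T \<union> U \<noteq> {}"
      using T U by (auto intro: subtree_closed_Un)
    then obtain f where f: "free_on \<eta> r (T \<union> U) f" "\<forall>v\<in>T. f v = e v"
      using free_on_extend[OF TU(1,2) r(1,2) tot[OF TU(3)], of \<eta> T e] \<eta>'[OF TU(3)] T by blast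
    have "el n \<in> C" using el by blast
    obtain T' e' where "T \<union> U \<subseteq> T'" "T' \<subseteq> trees_over S" "finite T'" "subtree_closed T'"
      "free_on \<eta> r T' e'" "\<forall>v\<in>T \<union> U. e' v = f v" "el n \<in> e' ` T'"
      using free_on_hit[OF TU(1,2,4,3) r \<eta> f(1) \<open>el n \<in> C\<close>] by (elim exE conjE) (rule that)
    then show ?thesis
      using T(3) U(3) f(2) by (intro exI[of _ "(T', e')"]) (auto simp: good_def step_def x)
  qed
  obtain s where s: "\<And>n. good (s n)" "\<And>n. step n (s n) (s (Suc n))"
    using dependent_nat_choice[of "\<lambda>_. good" step] start next_step by metis
  define T where "T n = fst (s n)" for n
  define e where "e n = snd (s n)" for n
  have T: "finite (T n)" "subtree_closed (T n)" "T n \<subseteq> trees_over S" "free_on \<eta> r (T n) (e n)" for n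
    using s(1)[of n] unfolding good_def T_def e_def by (auto simp: case_prod_unfold)
  have T_Suc: "T n \<subseteq> T (Suc n)" "\<And>v. v \<in> T n \<Longrightarrow> e (Suc n) v = e n v"
    "tr n \<in> T (Suc n)" "el n \<in> e (Suc n) ` T (Suc n)" for n
    using s(2)[of n] unfolding step_def T_def e_def by (auto simp: case_prod_unfold)
  have mono: "T m \<subseteq> T n" if "m \<le> n" for m n
    using lift_Suc_mono_le[of T] T_Suc(1) that by blast
  have agree: "e n v = e m v" if "m \<le> n" "v \<in> T m" for m n v
    using that
  proof (induction n rule: dec_induct)
    case (step n)
    then show ?case using T_Suc(2)[of v n] mono[of m n] by auto
  qed simp
  \<comment> \<open>Any stage that contains \<open>v\<close> gives the same value, by
    \<open>agree\<close>; the least one is merely a choice.\<close>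
  define E where "E v = e (LEAST n. v \<in> T n) v" for v
  have E: "E v = e n v" if "v \<in> T n" for v n
    unfolding E_def using agree[of "LEAST n. v \<in> T n" n v] that
    by (metis (mono_tags, lifting) LeastI Least_le)
  have cover: "\<exists>n. v \<in> T n" if "v \<in> trees_over S" for v
    using that tr T_Suc(3) by (metis imageE)
  have "E ` trees_over S = C"
  proof
    show "E ` trees_over S \<subseteq> C"
    proof
      fix x assume "x \<in> E ` trees_over S"
      then obtain v n where "v \<in> T n" "x = E v" using cover by blast
      then show "x \<in> C" using E free_onD(1)[OF T(4)[of n]] by auto
    qed
    show "C \<subseteq> E ` trees_over S"
    proof
      fix x assume "x \<in> C"
      then obtain n where "x = el n" using el by blast
      then obtain v where "v \<in> T (Suc n)" "x = e (Suc n) v" using T_Suc(4) by blast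
      then have "x = E v" "v \<in> trees_over S" using E[of v "Suc n"] T(3)[of "Suc n"] by auto
      then show "x \<in> E ` trees_over S" by blast
    qed
  qed
  moreover have "free_on \<eta> r U E" if U: "finite U" "subtree_closed U" "U \<subseteq> trees_over S" for U
  proof -
    have "\<exists>n. U \<subseteq> T n" using U(1,3)
    proof (induction U rule: finite_induct)
      case (insert v U)
      obtain m where "U \<subseteq> T m" using insert.IH insert.prems by auto
      moreover obtain n where "v \<in> T n" using cover[of v] insert.prems by auto
      ultimately have "insert v U \<subseteq> T (max m n)" using mono[of m "max m n"] mono[of n "max m n"] by auto
      then show ?case by blast
    qed simp
    then obtain n where n: "U \<subseteq> T n" by blast
    have "free_on \<eta> r U (e n)" using T(4)[of n] T(1) n U(2) by (rule free_on_subset)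
    then show ?thesis using U(2) by (rule free_on_cong) (use E n in auto)
  qed
  ultimately show ?thesis by blast
qed

section \<open>Relabelling of leaves\<close>

text \<open>Relabelling leaves the codes \<open>t\<close> unchanged and matches the trees below a
  node with those below its image, so node conditions can be pulled back. Combined with uniqueness,
  this compares the assignments of two structures. The hypothesis on \<open>\<eta>\<close> and
  \<open>\<eta>'\<close> is what homogeneity supplies for two embeddings of the same
  structure.\<close>

lemma free_on_transfer:
  fixes T :: "'u tree set" and f :: "'u \<Rightarrow> 'v"
  assumes e: "free_on \<eta>' r' (map_tree f ` T) e" and T: "subtree_closed T" "T \<subseteq> trees_over S"
    and f: "inj_on f S" "\<And>x y. x \<in> S \<Longrightarrow> y \<in> S \<Longrightarrow> (f x, f y) \<in> r' \<longleftrightarrow> (x, y) \<in> r"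
    and \<eta>: "\<exists>g\<in>G. \<forall>a. Leaf a \<in> T \<longrightarrow> \<eta>' (f a) = g (\<eta> a)"
  shows "free_on \<eta> r T (e \<circ> map_tree f)"
proof -
  let ?f = "map_tree f"
  have "node_condition r T (e \<circ> ?f) w ws t" if N: "Node w ws t \<in> T" for w ws t
  proof -
    have "node_condition r' (?f ` T) e (?f w) (map ?f ws) t"
      using free_onD(3)[OF e, of "?f w" "map ?f ws" t] imageI[OF N, of ?f] by simp
    moreover have "{v \<in> ?f ` T. (v, ?f (Node w ws t)) \<in> tree_order r'} =
        ?f ` {v \<in> T. (v, Node w ws t) \<in> tree_order r}"
      using tree_order_map_iff[OF f, of _ "Node w ws t"] T(2) N by blast
    ultimately show ?thesis
      unfolding node_condition_def by (simp add: image_image comp_def split: if_splits)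
  qed
  moreover have "(e \<circ> ?f) ` T \<subseteq> C" using free_onD(1)[OF e] by auto
  moreover obtain g h where g: "g \<in> G" "\<forall>a. Leaf a \<in> T \<longrightarrow> \<eta>' (f a) = g (\<eta> a)"
    and h: "h \<in> G" "\<forall>a. Leaf a \<in> ?f ` T \<longrightarrow> e (Leaf a) = h (\<eta>' a)"
    using \<eta> free_onD(2)[OF e] by blast
  have "(e \<circ> ?f) (Leaf a) = (h \<circ> g) (\<eta> a)" if "Leaf a \<in> T" for a
    using g(2) h(2) that imageI[OF that, of ?f] by simp
  then have "\<exists>g\<in>G. \<forall>a. Leaf a \<in> T \<longrightarrow> (e \<circ> ?f) (Leaf a) = g (\<eta> a)"
    using G_comp[OF h(1) g(1)] by blast
  ultimately show ?thesis unfolding free_on_def by blast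
qed

end


section \<open>Embeddings and generated substructures\<close>

lemma tuples_mono: "S \<subseteq> S' \<Longrightarrow> tuples S n \<subseteq> tuples S' n"
  unfolding tuples_def by auto

lemma tuples_image:
  assumes "xs \<in> tuples (h ` S) n"
  obtains ys where "ys \<in> tuples S n" "xs = map h ys"
proof -
  have "map h (map (inv_into S h) xs) = xs"
    using assms unfolding map_map by (intro map_idI) (auto simp: tuples_def f_inv_into_f)
  moreover have "map (inv_into S h) xs \<in> tuples S n"
    using assms by (auto simp: tuples_def inv_into_into)
  ultimately show thesis using that by metis
qed

lemma map_tuples: "(\<And>x. x \<in> S \<Longrightarrow> h x \<in> S') \<Longrightarrow> xs \<in> tuples S n \<Longrightarrow> map h xs \<in> tuples S' n"
  unfolding tuples_def by auto

lemma generated_superset: "X \<subseteq> generated L A X"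
  unfolding generated_def by blast

lemma generated_subset: "is_structure L A \<Longrightarrow> X \<subseteq> carrier A \<Longrightarrow> generated L A X \<subseteq> carrier A"
  unfolding generated_def is_structure_def by blast

lemma generated_minimal:
  "X \<subseteq> S \<Longrightarrow> S \<subseteq> carrier A \<Longrightarrow> fun_closed L A S \<Longrightarrow> generated L A X \<subseteq> S"
  unfolding generated_def by blast

lemma generated_mono: "X \<subseteq> Y \<Longrightarrow> generated L A X \<subseteq> generated L A Y"
  unfolding generated_def by blast

lemma fun_closed_generated: "fun_closed L A (generated L A X)"
  unfolding fun_closed_def
proof (intro ballI)
  fix f xs
  assume f: "f \<in> fun_syms L" and xs: "xs \<in> tuples (generated L A X) (fun_arity L f)"
  have "fn A f xs \<in> S" if S: "X \<subseteq> S" "S \<subseteq> carrier A" "fun_closed L A S" for S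
    using S(3) f xs tuples_mono[OF generated_minimal[OF S]] unfolding fun_closed_def by blast
  then show "fn A f xs \<in> generated L A X" unfolding generated_def by blast
qed

lemma generated_Un_generated:
  assumes "is_structure L A" "X \<subseteq> Y" "Y \<subseteq> carrier A"
  shows "generated L A (generated L A X \<union> generated L A Y) = generated L A Y"
proof
  show "generated L A (generated L A X \<union> generated L A Y) \<subseteq> generated L A Y"
    by (rule generated_minimal[OF _ _ fun_closed_generated])
      (use generated_mono[OF assms(2), of L A] generated_subset[OF assms(1,3)] in auto)
  show "generated L A Y \<subseteq> generated L A (generated L A X \<union> generated L A Y)"
    using generated_superset[of "generated L A X \<union> generated L A Y" L A] by blast
qed

lemma fin_gen_sub_generated: "finite X \<Longrightarrow> X \<subseteq> carrier A \<Longrightarrow> fin_gen_sub L A (generated L A X)"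
  unfolding fin_gen_sub_def by blast

section \<open>Embeddings and isomorphisms\<close>

lemma embeddingsI:
  assumes "h \<in> carrier A \<rightarrow>\<^sub>E carrier B" "inj_on h (carrier A)"
    and "\<And>f xs. f \<in> fun_syms L \<Longrightarrow> xs \<in> tuples (carrier A) (fun_arity L f) \<Longrightarrow> h (fn A f xs) = fn B f (map h xs)"
    and "\<And>R xs. R \<in> rel_syms L \<Longrightarrow> xs \<in> tuples (carrier A) (rel_arity L R) \<Longrightarrow>
      xs \<in> rel A R \<longleftrightarrow> map h xs \<in> rel B R"
  shows "h \<in> embeddings L A B"
  using assms unfolding embeddings_def by blast

lemma embeddingsD:
  assumes "h \<in> embeddings L A B"
  shows "h \<in> carrier A \<rightarrow>\<^sub>E carrier B" "inj_on h (carrier A)"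
    and "f \<in> fun_syms L \<Longrightarrow> xs \<in> tuples (carrier A) (fun_arity L f) \<Longrightarrow> h (fn A f xs) = fn B f (map h xs)"
    and "R \<in> rel_syms L \<Longrightarrow> xs \<in> tuples (carrier A) (rel_arity L R) \<Longrightarrow> xs \<in> rel A R \<longleftrightarrow> map h xs \<in> rel B R"
    and "x \<in> carrier A \<Longrightarrow> h x \<in> carrier B"
  using assms unfolding embeddings_def by auto

lemma embeddings_compose:
  assumes f: "f \<in> embeddings L A B" and g: "g \<in> embeddings L B C" and A: "is_structure L A"
  shows "compose (carrier A) g f \<in> embeddings L A C"
proof (rule embeddingsI)
  note fD = embeddingsD[OF f] and gD = embeddingsD[OF g]
  show "compose (carrier A) g f \<in> carrier A \<rightarrow>\<^sub>E carrier C"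
    using fD(5) gD(5) by (auto simp: compose_def)
  show "inj_on (compose (carrier A) g f) (carrier A)"
    using fD(2,5) gD(2) by (auto simp: inj_on_def compose_def)
  have map: "map (compose (carrier A) g f) xs = map g (map f xs)" if "xs \<in> tuples (carrier A) n" for xs n
    using that by (auto simp: tuples_def compose_def)
  have tup: "map f xs \<in> tuples (carrier B) n" if "xs \<in> tuples (carrier A) n" for xs n
    using that by (rule map_tuples[rotated]) (rule fD(5))
  show "compose (carrier A) g f (fn A s xs) = fn C s (map (compose (carrier A) g f) xs)"
    if "s \<in> fun_syms L" "xs \<in> tuples (carrier A) (fun_arity L s)" for s xs
  proof -
    have "fn A s xs \<in> carrier A" using A that unfolding is_structure_def fun_closed_def by blast
    then show ?thesis
      using fD(3)[OF that] gD(3)[OF that(1) tup[OF that(2)]] unfolding map[OF that(2)] by (simp add: compose_eq)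
  qed
  show "xs \<in> rel A R \<longleftrightarrow> map (compose (carrier A) g f) xs \<in> rel C R"
    if "R \<in> rel_syms L" "xs \<in> tuples (carrier A) (rel_arity L R)" for R xs
    using fD(4)[OF that] gD(4)[OF that(1) tup[OF that(2)]] unfolding map[OF that(2)] by simp
qed

text \<open>Each clause of the definition of an embedding mentions finitely many elements; for a
  function symbol the value has to be included along with the arguments.\<close>

lemma embeddings_if_locally_embedding:
  assumes A: "is_structure L A" and h: "h \<in> carrier A \<rightarrow>\<^sub>E carrier B"
    and loc: "\<And>X. finite X \<Longrightarrow> X \<subseteq> carrier A \<Longrightarrow> \<exists>g\<in>embeddings L A B. \<forall>x\<in>X. h x = g x"
  shows "h \<in> embeddings L A B"
proof (rule embeddingsI[OF h])
  show "inj_on h (carrier A)"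
  proof (rule inj_onI)
    fix x y assume xy: "x \<in> carrier A" "y \<in> carrier A" "h x = h y"
    obtain g where "g \<in> embeddings L A B" "\<forall>z\<in>{x, y}. h z = g z" using loc[of "{x, y}"] xy by auto
    then show "x = y" using xy embeddingsD(2) by (fastforce simp: inj_on_def)
  qed
  show "h (fn A s xs) = fn B s (map h xs)"
    if s: "s \<in> fun_syms L" and xs: "xs \<in> tuples (carrier A) (fun_arity L s)" for s xs
  proof -
    have "fn A s xs \<in> carrier A" using A s xs unfolding is_structure_def fun_closed_def by blast
    then obtain g where g: "g \<in> embeddings L A B" "\<forall>x\<in>insert (fn A s xs) (set xs). h x = g x"
      using loc[of "insert (fn A s xs) (set xs)"] xs by (auto simp: tuples_def)
    have map: "map h xs = map g xs" using g(2) by auto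
    show ?thesis unfolding map using g(2) embeddingsD(3)[OF g(1) s xs] by simp
  qed
  show "xs \<in> rel A R \<longleftrightarrow> map h xs \<in> rel B R"
    if R: "R \<in> rel_syms L" and xs: "xs \<in> tuples (carrier A) (rel_arity L R)" for R xs
  proof -
    obtain g where g: "g \<in> embeddings L A B" "\<forall>x\<in>set xs. h x = g x"
      using loc[of "set xs"] xs by (auto simp: tuples_def)
    have map: "map h xs = map g xs" using g(2) by auto
    show ?thesis unfolding map by (rule embeddingsD(4)[OF g(1) R xs])
  qed
qed

lemma isomorphismsD:
  assumes "h \<in> isomorphisms L A B"
  shows "h \<in> embeddings L A B" "h ` carrier A = carrier B"
  using assms unfolding isomorphisms_def by auto

lemma isomorphisms_compose:
  assumes "f \<in> isomorphisms L A B" "g \<in> isomorphisms L B C" "is_structure L A"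
  shows "compose (carrier A) g f \<in> isomorphisms L A C"
proof -
  have "compose (carrier A) g f ` carrier A = g ` f ` carrier A" by (simp add: compose_def image_image)
  then show ?thesis
    using assms embeddings_compose[of f L A B g C] unfolding isomorphisms_def by auto
qed

lemma isomorphisms_inverse:
  assumes h: "h \<in> isomorphisms L A B" and A: "is_structure L A"
  shows "restrict (inv_into (carrier A) h) (carrier B) \<in> isomorphisms L B A" (is "?k \<in> _")
proof -
  note hD = isomorphismsD[OF h] and hE = embeddingsD[OF isomorphismsD(1)[OF h]]
  have kh: "?k (h x) = x" if "x \<in> carrier A" for x
    using that hE(2,5) by (simp add: inv_into_f_f)
  have hk: "h (?k y) = y" "?k y \<in> carrier A" if "y \<in> carrier B" for y
    using that hD(2) by (auto simp: f_inv_into_f inv_into_into)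
  have map: "map h (map ?k xs) = xs" "map ?k xs \<in> tuples (carrier A) n" if "xs \<in> tuples (carrier B) n" for xs n
  proof -
    show "map h (map ?k xs) = xs"
      using that hk(1) unfolding map_map by (intro map_idI) (auto simp: tuples_def)
    show "map ?k xs \<in> tuples (carrier A) n"
      using hk(2) that by (rule map_tuples)
  qed
  have "?k \<in> embeddings L B A"
  proof (rule embeddingsI)
    show "?k \<in> carrier B \<rightarrow>\<^sub>E carrier A" using hk(2) by auto
    show "inj_on ?k (carrier B)" using hk(1) by (rule inj_on_inverseI)
    show "?k (fn B s xs) = fn A s (map ?k xs)"
      if s: "s \<in> fun_syms L" and xs: "xs \<in> tuples (carrier B) (fun_arity L s)" for s xs
    proof -
      have "h (fn A s (map ?k xs)) = fn B s xs" using hE(3)[OF s map(2)[OF xs]] map(1)[OF xs] by simp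
      moreover have "fn A s (map ?k xs) \<in> carrier A"
        using A s map(2)[OF xs] unfolding is_structure_def fun_closed_def by blast
      ultimately show ?thesis using kh by metis
    qed
    show "xs \<in> rel B R \<longleftrightarrow> map ?k xs \<in> rel A R"
      if "R \<in> rel_syms L" "xs \<in> tuples (carrier B) (rel_arity L R)" for R xs
      using hE(4)[OF that(1) map(2)[OF that(2)]] map(1)[OF that(2)] by simp
  qed
  moreover have "?k ` carrier B = carrier A"
    using kh hk hE(5) by (metis (no_types, lifting) image_eqI image_subsetI subsetI subset_antisym)
  ultimately show ?thesis unfolding isomorphisms_def by blast
qed

section \<open>Induced structures and images of generated substructures\<close>

lemma induced_simps [simp]:
  "carrier (induced A S) = S" "fn (induced A S) = fn A" "rel (induced A S) = rel A"
  by (simp_all add: induced_def)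

lemma is_structure_induced: "fun_closed L A S \<Longrightarrow> is_structure L (induced A S)"
  by (simp add: is_structure_def fun_closed_def)

lemma restrict_isomorphism:
  assumes h: "h \<in> embeddings L A B" and S: "S \<subseteq> carrier A" "fun_closed L A S"
  shows "restrict h S \<in> isomorphisms L (induced A S) (induced B (h ` S))"
proof -
  note hD = embeddingsD[OF h]
  have map: "map (restrict h S) xs = map h xs" if "xs \<in> tuples S n" for xs n
    using that by (auto simp: tuples_def)
  have "restrict h S \<in> embeddings L (induced A S) (induced B (h ` S))"
  proof (rule embeddingsI; unfold induced_simps)
    show "restrict h S \<in> S \<rightarrow>\<^sub>E h ` S" by auto
    show "inj_on (restrict h S) S"
      using hD(2) S(1) by (metis inj_on_restrict_eq inj_on_subset)
    show "restrict h S (fn A s xs) = fn B s (map (restrict h S) xs)"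
      if "s \<in> fun_syms L" "xs \<in> tuples S (fun_arity L s)" for s xs
      using that S(2) hD(3)[OF that(1) subsetD[OF tuples_mono[OF S(1)] that(2)]]
      unfolding fun_closed_def map[OF that(2)] by auto
    show "xs \<in> rel A R \<longleftrightarrow> map (restrict h S) xs \<in> rel B R"
      if "R \<in> rel_syms L" "xs \<in> tuples S (rel_arity L R)" for R xs
      unfolding map[OF that(2)] by (rule hD(4)[OF that(1) subsetD[OF tuples_mono[OF S(1)] that(2)]])
  qed
  then show ?thesis unfolding isomorphisms_def by simp
qed

lemma embedding_onto_image:
  assumes "h \<in> embeddings L A B" "is_structure L A"
  shows "h \<in> isomorphisms L A (induced B (h ` carrier A))"
  using assms unfolding isomorphisms_def embeddings_def by auto

lemma fun_closed_image:
  assumes h: "h \<in> embeddings L A B" and S: "S \<subseteq> carrier A" "fun_closed L A S"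
  shows "fun_closed L B (h ` S)"
  unfolding fun_closed_def
proof (intro ballI)
  fix f xs assume f: "f \<in> fun_syms L" and "xs \<in> tuples (h ` S) (fun_arity L f)"
  then obtain ys where ys: "ys \<in> tuples S (fun_arity L f)" "xs = map h ys" by (elim tuples_image)
  then have "fn B f xs = h (fn A f ys)"
    using embeddingsD(3)[OF h f] subsetD[OF tuples_mono[OF S(1)] ys(1)] by simp
  then show "fn B f xs \<in> h ` S" using S(2) f ys(1) unfolding fun_closed_def by blast
qed

text \<open>One inclusion holds because the preimage of a closed set is closed, the other because
  the image of a closed set is closed.\<close>

lemma image_generated:
  assumes h: "h \<in> embeddings L A B" and str: "is_structure L A" "is_structure L B" and X: "X \<subseteq> carrier A"
  shows "h ` generated L A X = generated L B (h ` X)"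
proof
  let ?S = "{x \<in> carrier A. h x \<in> generated L B (h ` X)}"
  have "fun_closed L A ?S"
    unfolding fun_closed_def
  proof (intro ballI)
    fix f xs assume f: "f \<in> fun_syms L" and xs: "xs \<in> tuples ?S (fun_arity L f)"
    have xsA: "xs \<in> tuples (carrier A) (fun_arity L f)" using xs tuples_mono[of ?S "carrier A"] by blast
    have "map h xs \<in> tuples (generated L B (h ` X)) (fun_arity L f)" using _ xs by (rule map_tuples) simp
    then have "fn B f (map h xs) \<in> generated L B (h ` X)"
      using fun_closed_generated[of L B "h ` X"] f unfolding fun_closed_def by blast
    moreover have "fn A f xs \<in> carrier A" using str(1) f xsA unfolding is_structure_def fun_closed_def by blast
    ultimately show "fn A f xs \<in> ?S" using embeddingsD(3)[OF h f xsA] by simp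
  qed
  then have "generated L A X \<subseteq> ?S"
    using X generated_superset[of "h ` X" L B] by (intro generated_minimal) auto
  then show "h ` generated L A X \<subseteq> generated L B (h ` X)" by blast
  show "generated L B (h ` X) \<subseteq> h ` generated L A X"
  proof (rule generated_minimal)
    show "h ` X \<subseteq> h ` generated L A X" by (intro image_mono generated_superset)
    show "h ` generated L A X \<subseteq> carrier B"
      using generated_subset[OF str(1) X] embeddingsD(5)[OF h] by blast
    show "fun_closed L B (h ` generated L A X)"
      using h generated_subset[OF str(1) X] fun_closed_generated by (rule fun_closed_image)
  qed
qed

text \<open>The fixed points of \<open>h\<close> form a closed set. This reduces pointwise fixing of
  a generated substructure to its generators.\<close>

lemma fixes_generated:
  assumes h: "h \<in> embeddings L A A" and str: "is_structure L A" and X: "X \<subseteq> carrier A" "\<forall>x\<in>X. h x = x"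
  shows "\<forall>x\<in>generated L A X. h x = x"
proof -
  let ?S = "{x \<in> carrier A. h x = x}"
  have "fun_closed L A ?S"
    unfolding fun_closed_def
  proof (intro ballI)
    fix f xs assume f: "f \<in> fun_syms L" and xs: "xs \<in> tuples ?S (fun_arity L f)"
    have xsA: "xs \<in> tuples (carrier A) (fun_arity L f)" using xs tuples_mono[of ?S "carrier A"] by blast
    moreover have "map h xs = xs" using xs by (intro map_idI) (auto simp: tuples_def)
    moreover have "fn A f xs \<in> carrier A" using str f xsA unfolding is_structure_def fun_closed_def by blast
    ultimately show "fn A f xs \<in> ?S" using embeddingsD(3)[OF h f] by simp
  qed
  then have "generated L A X \<subseteq> ?S" using X by (intro generated_minimal) auto
  then show ?thesis by blast
qed

section \<open>Homogeneity and automorphisms\<close>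

text \<open>On the image of a finitely generated part of \<open>A\<close>, the map
  \<open>\<beta>\<close> after the inverse of \<open>\<alpha>\<close> is an isomorphism between
  finitely generated substructures of \<open>M\<close>, which homogeneity extends.\<close>

lemma ultrahomogeneous_embeddings:
  assumes M: "ultrahomogeneous L M" "is_structure L M" and A: "is_structure L A"
    and emb: "\<alpha> \<in> embeddings L A M" "\<beta> \<in> embeddings L A M" and X: "finite X" "X \<subseteq> carrier A"
  shows "\<exists>g\<in>automorphisms L M. \<forall>x\<in>generated L A X. g (\<alpha> x) = \<beta> x"
proof -
  let ?S = "generated L A X"
  have S: "?S \<subseteq> carrier A" "fun_closed L A ?S"
    using generated_subset[OF A X(2)] fun_closed_generated by auto
  have iso: "restrict \<gamma> ?S \<in> isomorphisms L (induced A ?S) (induced M (\<gamma> ` ?S))"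
    if "\<gamma> \<in> embeddings L A M" for \<gamma>
    using that S by (rule restrict_isomorphism)
  have fg: "fin_gen_sub L M (\<gamma> ` ?S)" if "\<gamma> \<in> embeddings L A M" for \<gamma>
    unfolding image_generated[OF that A M(2) X(2)]
    using X embeddingsD(5)[OF that] by (intro fin_gen_sub_generated) auto
  define k where "k = restrict (inv_into ?S (restrict \<alpha> ?S)) (\<alpha> ` ?S)"
  have "k \<in> isomorphisms L (induced M (\<alpha> ` ?S)) (induced A ?S)"
    using isomorphisms_inverse[OF iso[OF emb(1)]] is_structure_induced[OF S(2)] by (simp add: k_def)
  then have "compose (\<alpha> ` ?S) (restrict \<beta> ?S) k \<in> isomorphisms L (induced M (\<alpha> ` ?S)) (induced M (\<beta> ` ?S))"
    using isomorphisms_compose[OF _ iso[OF emb(2)]]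
      is_structure_induced[OF fun_closed_image[OF emb(1) S]] by fastforce
  then obtain g where g: "g \<in> automorphisms L M"
    "\<forall>y\<in>\<alpha> ` ?S. g y = compose (\<alpha> ` ?S) (restrict \<beta> ?S) k y"
    using M(1) fg[OF emb(1)] fg[OF emb(2)] unfolding ultrahomogeneous_def by blast
  have "g (\<alpha> x) = \<beta> x" if "x \<in> ?S" for x
  proof -
    have "inj_on (restrict \<alpha> ?S) ?S"
      using embeddingsD(2)[OF emb(1)] S(1) by (metis inj_on_restrict_eq inj_on_subset)
    then have "k (\<alpha> x) = x"
      using inv_into_f_f[of "restrict \<alpha> ?S" ?S x] that by (simp add: k_def)
    then show ?thesis using g(2) that by (simp add: compose_eq)
  qed
  then show ?thesis using g(1) by blast
qed

lemma automorphismsD: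
  assumes "g \<in> automorphisms L A"
  shows "g \<in> embeddings L A A" "g ` carrier A = carrier A" "restrict g (carrier A) = g"
    "x \<in> carrier A \<Longrightarrow> g x \<in> carrier A"
proof -
  show *: "g \<in> embeddings L A A" "g ` carrier A = carrier A"
    using assms isomorphismsD unfolding automorphisms_def by blast+
  show "restrict g (carrier A) = g"
    using embeddingsD(1)[OF *(1)] by (auto simp: PiE_def extensional_restrict)
  show "x \<in> carrier A \<Longrightarrow> g x \<in> carrier A" using embeddingsD(5)[OF *(1)] .
qed

lemma id_automorphism:
  assumes "is_structure L A" shows "(\<lambda>x\<in>carrier A. x) \<in> automorphisms L A"
proof -
  have map: "map (\<lambda>x\<in>carrier A. x) xs = xs" if "xs \<in> tuples (carrier A) n" for xs n
    using that by (intro map_idI) (auto simp: tuples_def)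
  have "(\<lambda>x\<in>carrier A. x) \<in> embeddings L A A"
  proof (rule embeddingsI)
    show "(\<lambda>x\<in>carrier A. x) (fn A s xs) = fn A s (map (\<lambda>x\<in>carrier A. x) xs)"
      if "s \<in> fun_syms L" "xs \<in> tuples (carrier A) (fun_arity L s)" for s xs
      using assms that unfolding map[OF that(2)] is_structure_def fun_closed_def by simp
  qed (auto simp: map inj_on_def)
  then show ?thesis unfolding automorphisms_def isomorphisms_def by auto
qed


section \<open>The functor\<close>

text \<open>\<open>G\<close> consists of the functions whose restriction is an automorphism rather
  than of the extensional automorphisms themselves; this makes it contain \<open>id\<close> and be
  closed under ordinary composition. Independence of points and finite sets means independence of
  the substructures they generate.\<close>

lemma swir_pointwise_independence:
  assumes M: "fraisse_structure L M" and ind: "local_swir L M ind"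
  shows "pointwise_independence (carrier M) {g. restrict g (carrier M) \<in> automorphisms L M}
    (\<lambda>b A D. ind (generated L M {b}) (generated L M A) (generated L M D))
    (from_nat_into (lists (carrier M)))"
    (is "pointwise_independence ?C ?G ?J _")
proof -
  let ?gen = "generated L M"
  have str: "is_structure L M" and cnt: "countable ?C"
    using M unfolding fraisse_structure_def by auto
  have inv: "swir_invariance L M ind" and ex: "swir_existence L M ind"
    and stat: "swir_stationarity L M ind" and mono: "swir_monotonicity L M ind"
    using ind unfolding local_swir_def by auto
  have fg: "fin_gen_sub L M (?gen X)" if "finite X" "X \<subseteq> ?C" for X
    using that by (rule fin_gen_sub_generated)
  have ne: "?gen X \<noteq> {}" if "X \<noteq> {}" for X using that generated_superset[of X L M] by blast
  have img: "g ` ?gen X = ?gen (g ` X)" if "g \<in> automorphisms L M" "X \<subseteq> ?C" for g X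
    using automorphismsD(1)[OF that(1)] str str that(2) by (rule image_generated)
  have aut_fix: "g \<in> aut_fixing L M (?gen X)" if "g \<in> automorphisms L M" "\<forall>x\<in>X. g x = x" "X \<subseteq> ?C" for g X
    using fixes_generated[OF automorphismsD(1)[OF that(1)] str that(3,2)] that(1)
    unfolding aut_fixing_def by blast
  have restr: "restrict g ?C ` ?gen X = ?gen (g ` X)" "\<forall>x\<in>X. restrict g ?C x = g x"
    if "restrict g ?C \<in> automorphisms L M" "X \<subseteq> ?C" for g X
  proof -
    have "restrict g ?C ` X = g ` X" using that(2) by (auto intro!: image_cong)
    then show "restrict g ?C ` ?gen X = ?gen (g ` X)" using img[OF that] by simp
    show "\<forall>x\<in>X. restrict g ?C x = g x" using that(2) by auto
  qed
  have Aut_G: "g \<in> ?G" if "g \<in> automorphisms L M" for g using automorphismsD(3)[OF that] that by simp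
  show ?thesis
  proof
    show "countable ?C" by (rule cnt)
    show "g x \<in> ?C" if "g \<in> ?G" "x \<in> ?C" for g x
      using automorphismsD(4)[of "restrict g ?C" L M x] that by simp
    show "id \<in> ?G" using id_automorphism[OF str] by (simp add: id_def)
    show "g \<circ> h \<in> ?G" if "g \<in> ?G" "h \<in> ?G" for g h
    proof -
      have "compose ?C (restrict g ?C) (restrict h ?C) = restrict (g \<circ> h) ?C"
        using automorphismsD(4)[of "restrict h ?C" L M] that(2) by (auto simp: compose_def restrict_def fun_eq_iff)
      then show ?thesis
        using isomorphisms_compose[of "restrict h ?C" L M M "restrict g ?C" M] that str
        unfolding automorphisms_def by simp
    qed
    show "\<exists>h\<in>?G. \<forall>x\<in>?C. h (g x) = x \<and> g (h x) = x" if "g \<in> ?G" for g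
    proof -
      let ?g = "restrict g ?C"
      let ?h = "restrict (inv_into ?C ?g) ?C"
      have g: "?g \<in> automorphisms L M" using that by simp
      have "?h \<in> automorphisms L M"
        using isomorphisms_inverse[of ?g L M M] g str unfolding automorphisms_def by simp
      then have "?h \<in> ?G" by (rule Aut_G)
      moreover have "?h (g x) = x" if "x \<in> ?C" for x
        using inv_into_f_f[OF embeddingsD(2)[OF automorphismsD(1)[OF g]] that] automorphismsD(4)[OF g that] that
        by simp
      moreover have "g (?h x) = x" if "x \<in> ?C" for x
      proof -
        have x: "x \<in> ?g ` ?C" using automorphismsD(2)[OF g] that by simp
        show ?thesis using f_inv_into_f[OF x] inv_into_into[OF x] that by simp
      qed
      ultimately show ?thesis by blast
    qed
    show "range (from_nat_into (lists ?C)) = lists ?C"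
      using cnt by (intro range_from_nat_into countable_lists) auto
    show "?J (g b) (g ` A) (g ` D)"
      if "g \<in> ?G" "b \<in> ?C" "finite A" "A \<noteq> {}" "A \<subseteq> ?C" "finite D" "D \<subseteq> ?C" "?J b A D" for g b A D
    proof -
      have g: "restrict g ?C \<in> automorphisms L M" using that(1) by simp
      have "ind (restrict g ?C ` ?gen {b}) (restrict g ?C ` ?gen A) (restrict g ?C ` ?gen D)"
        using inv g that(8) fg[of "{b}"] fg[OF that(3,5)] fg[OF that(6,7)] ne[OF that(4)] that(2)
        unfolding swir_invariance_def by blast
      then show ?thesis using restr(1)[OF g] that(2,5,7) by simp
    qed
    show "\<exists>g\<in>?G. (\<forall>x\<in>A. g x = x) \<and> ?J (g b) A D"
      if b: "b \<in> ?C" "finite A" "A \<noteq> {}" "A \<subseteq> ?C" "finite D" "D \<subseteq> ?C" for b A D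
    proof -
      obtain g where g: "g \<in> aut_fixing L M (?gen A)" "ind (g ` ?gen {b}) (?gen A) (?gen D)"
        using ex fg[of "{b}"] fg[OF b(2,4)] fg[OF b(5,6)] ne[OF b(3)] b(1)
        unfolding swir_existence_def by blast
      then have "g \<in> automorphisms L M" "\<forall>x\<in>A. g x = x"
        using generated_superset[of A L M] unfolding aut_fixing_def by auto
      then show ?thesis using Aut_G[of g] img[of g "{b}"] g(2) b(1) by auto
    qed
    show "\<exists>g\<in>?G. (\<forall>x\<in>D. g x = x) \<and> g b = h b"
      if h: "b \<in> ?C" "finite A" "A \<noteq> {}" "A \<subseteq> ?C" "finite D" "D \<subseteq> ?C"
        "h \<in> ?G" "\<forall>x\<in>A. h x = x" "?J b A D" "?J (h b) A D" for b A D h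
    proof -
      let ?h = "restrict h ?C"
      have aut: "?h \<in> automorphisms L M" using h(7) by simp
      have "?h \<in> aut_fixing L M (?gen A)"
        using aut restr(2)[OF aut h(4)] h(8,4) by (intro aut_fix) auto
      moreover have "?h ` ?gen {b} = ?gen {h b}" using restr(1)[OF aut, of "{b}"] h(1) by simp
      moreover have "h b \<in> ?C" using automorphismsD(4)[OF aut h(1)] h(1) by simp
      ultimately have "\<exists>g\<in>aut_fixing L M (?gen (?gen A \<union> ?gen D)). \<forall>x\<in>?gen {b}. g x = ?h x"
        using conjunct1[OF stat[unfolded swir_stationarity_def], rule_format,
            of "?gen A" "?gen {b}" "?gen {h b}" "?gen D" ?h]
          fg[of "{b}"] fg[of "{h b}"] fg[OF h(2,4)] fg[OF h(5,6)] ne[OF h(3)] h(1,9,10) by simp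
      then obtain g where g: "g \<in> aut_fixing L M (?gen (?gen A \<union> ?gen D))" "\<forall>x\<in>?gen {b}. g x = ?h x" ..
      have "D \<subseteq> ?gen (?gen A \<union> ?gen D)"
        using generated_superset[of D L M] generated_superset[of "?gen A \<union> ?gen D" L M] by blast
      moreover have "g b = h b" using g(2) generated_superset[of "{b}" L M] h(1) by auto
      ultimately show ?thesis using g(1) Aut_G[of g] unfolding aut_fixing_def by blast
    qed
    show "?J b A D'"
      if "b \<in> ?C" "finite A" "A \<noteq> {}" "A \<subseteq> ?C" "finite D" "D \<subseteq> ?C" "D' \<subseteq> D" "?J b A D" for b A D D'
    proof -
      have "finite D'" "D' \<subseteq> ?C" using that(5-7) finite_subset by auto
      \<comment> \<open>Monotonicity speaks of a substructure generated by a union; as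
        \<open>D'\<close> is part of \<open>D\<close>, joining it to \<open>D\<close> generates
        nothing new.\<close>
      moreover have "ind (?gen {b}) (?gen A) (?gen (?gen D' \<union> ?gen D))"
        using generated_Un_generated[OF str that(7,6)] that(8) by simp
      ultimately show ?thesis
        using mono that(1) fg[of "{b}"] fg[OF that(2,4)] fg[OF that(5,6)] fg[of D'] ne[OF that(3)]
        unfolding swir_monotonicity_def by blast
    qed
  qed
qed

section \<open>The order on members of the \<omega>-age\<close>

definition strict_order :: "'r \<Rightarrow> ('f, 'r, 'a) fo_structure \<Rightarrow> ('a \<times> 'a) set" where
  "strict_order leq A = {(x, y) \<in> carrier A \<times> carrier A. x \<noteq> y \<and> [x, y] \<in> rel A leq}"

lemma strict_order_embedding_iff:
  assumes "linearly_ordered_by L leq M" "f \<in> embeddings L A B" "x \<in> carrier A" "y \<in> carrier A"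
  shows "(f x, f y) \<in> strict_order leq B \<longleftrightarrow> (x, y) \<in> strict_order leq A"
proof -
  have "[x, y] \<in> rel A leq \<longleftrightarrow> map f [x, y] \<in> rel B leq"
    using assms by (intro embeddingsD(4)[OF assms(2)]) (auto simp: linearly_ordered_by_def tuples_def)
  then show ?thesis
    using assms(3,4) embeddingsD(5)[OF assms(2)] inj_on_eq_iff[OF embeddingsD(2)[OF assms(2)]]
    by (simp add: strict_order_def)
qed

text \<open>All that is known about \<open>A\<close> is that it embeds into \<open>M\<close>;
  linearity is pulled back from \<open>M\<close> along \<open>f\<close>.\<close>

lemma strict_order_linear:
  assumes ord: "linearly_ordered_by L leq M" and f: "f \<in> embeddings L A M"
  shows "trans (strict_order leq A)" "irrefl (strict_order leq A)" "total_on (carrier A) (strict_order leq A)"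
proof -
  define R where "R = {(x, y) \<in> carrier M \<times> carrier M. [x, y] \<in> rel M leq}"
  have "linear_order_on (carrier M) R" using ord unfolding linearly_ordered_by_def R_def by simp
  then have t: "trans R" and a: "antisym R" and tot: "total_on (carrier M) R"
    by (simp_all add: linear_order_on_def partial_order_on_def preorder_on_def)
  note iff = strict_order_embedding_iff[OF ord f] and f5 = embeddingsD(5)[OF f]
  have SR: "(u, v) \<in> strict_order leq M \<longleftrightarrow> (u, v) \<in> R \<and> u \<noteq> v" for u v
    unfolding strict_order_def R_def by auto
  have in_A: "x \<in> carrier A \<and> y \<in> carrier A" if "(x, y) \<in> strict_order leq A" for x y
    using that unfolding strict_order_def by auto
  show "trans (strict_order leq A)"
  proof (rule transI)
    fix x y z assume xy: "(x, y) \<in> strict_order leq A" and yz: "(y, z) \<in> strict_order leq A"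
    then have A: "x \<in> carrier A" "y \<in> carrier A" "z \<in> carrier A" using in_A by blast+
    have "(f x, f y) \<in> R" "(f y, f z) \<in> R" "f x \<noteq> f y"
      using xy yz iff A SR by blast+
    then have "(f x, f z) \<in> R" "f x \<noteq> f z" using transD[OF t] antisymD[OF a] by metis+
    then show "(x, z) \<in> strict_order leq A" using iff[OF A(1,3)] SR by blast
  qed
  show "irrefl (strict_order leq A)" by (auto simp: irrefl_def strict_order_def)
  show "total_on (carrier A) (strict_order leq A)"
  proof (rule total_onI)
    fix x y assume xy: "x \<in> carrier A" "y \<in> carrier A" "x \<noteq> y"
    then have "f x \<noteq> f y" using inj_on_eq_iff[OF embeddingsD(2)[OF f]] by blast
    then have "(f x, f y) \<in> R \<or> (f y, f x) \<in> R"
      using tot f5[OF xy(1)] f5[OF xy(2)] unfolding total_on_def by blast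
    then show "(x, y) \<in> strict_order leq A \<or> (y, x) \<in> strict_order leq A"
      using iff xy(1,2) SR \<open>f x \<noteq> f y\<close> by metis
  qed
qed

section \<open>Trees as names for the elements of \<open>M\<close>, and the induced functor\<close>

lemma omega_age_objectsD:
  assumes "A \<in> omega_age_objects L M"
  shows "is_structure L A" "embeddings L A M \<noteq> {}" "carrier A \<noteq> {}"
  using assms unfolding omega_age_objects_def omega_age_def by auto

lemma map_tree_in_trees_over:
  assumes "f \<in> embeddings L A B" "w \<in> trees_over (carrier A)"
  shows "map_tree f w \<in> trees_over (carrier B)"
  using assms embeddingsD(5)[OF assms(1)] by (auto simp: tree.set_map)

text \<open>For the last clause, \<open>e A\<close> and the pullback of \<open>e B\<close> along the
  relabelling are both free, with respect to \<open>\<eta> A\<close>, on a finite subtree-closed set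
  containing \<open>W\<close>, so uniqueness yields \<open>g\<close>. The automorphism depends on
  \<open>W\<close>; passing to all trees leaves only an embedding.\<close>

lemma tree_presentation_exists:
  fixes M :: "('f, 'r, 'a) fo_structure"
  assumes M: "fraisse_structure L M" "linearly_ordered_by L leq M" and ind: "local_swir L M ind"
  shows "\<exists>e :: ('f, 'r, 'u) fo_structure \<Rightarrow> 'u tree \<Rightarrow> 'a. \<forall>A\<in>omega_age_objects L M.
    e A ` trees_over (carrier A) = carrier M \<and>
    (\<lambda>a\<in>carrier A. e A (Leaf a)) \<in> embeddings L A M \<and>
    (\<forall>B\<in>omega_age_objects L M. \<forall>f\<in>embeddings L A B. \<forall>W. finite W \<longrightarrow> W \<subseteq> trees_over (carrier A) \<longrightarrow>
      (\<exists>g\<in>automorphisms L M. \<forall>w\<in>W. e B (map_tree f w) = g (e A w)))"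
proof -
  let ?\<Omega> = "omega_age_objects L M :: ('f, 'r, 'u) fo_structure set"
  let ?C = "carrier M"
  have str: "is_structure L M" and cnt: "countable ?C" and hom: "ultrahomogeneous L M"
    using M(1) unfolding fraisse_structure_def by auto
  interpret pointwise_independence ?C "{g. restrict g ?C \<in> automorphisms L M}"
    "\<lambda>b A D. ind (generated L M {b}) (generated L M A) (generated L M D)" "from_nat_into (lists ?C)"
    using M(1) ind by (rule swir_pointwise_independence)
  \<comment> \<open>An arbitrary choice of embeddings, with no compatibility between different
    structures; homogeneity makes up for this below.\<close>
  define \<eta> where "\<eta> A = (SOME h. h \<in> embeddings L A M)" for A :: "('f, 'r, 'u) fo_structure"
  have \<eta>: "\<eta> A \<in> embeddings L A M" if "A \<in> ?\<Omega>" for A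
    unfolding \<eta>_def using omega_age_objectsD(2)[OF that] by (simp add: some_in_eq)
  let ?r = "\<lambda>A. strict_order leq A"
  let ?P = "\<lambda>A e. e ` trees_over (carrier A) = ?C \<and>
    (\<forall>T. finite T \<longrightarrow> subtree_closed T \<longrightarrow> T \<subseteq> trees_over (carrier A) \<longrightarrow> free_on (\<eta> A) (?r A) T e)"
  define e where "e A = (SOME e. ?P A e)" for A
  have e: "?P A (e A)" if A: "A \<in> ?\<Omega>" for A
  proof -
    have "\<eta> A ` carrier A \<subseteq> ?C" using embeddingsD(5)[OF \<eta>[OF A]] by blast
    moreover have "countable (carrier A)"
      using countable_image_inj_on[OF countable_subset[OF calculation cnt] embeddingsD(2)[OF \<eta>[OF A]]] .
    ultimately have "\<exists>e. ?P A e"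
      using omega_age_objectsD(3)[OF A] strict_order_linear[OF M(2) \<eta>[OF A]]
      by (intro free_surjection_exists)
    then show ?thesis unfolding e_def by (rule someI_ex)
  qed
  have surj: "e A ` trees_over (carrier A) = ?C" if "A \<in> ?\<Omega>" for A using e[OF that] by (rule conjunct1)
  have free: "free_on (\<eta> A) (?r A) T (e A)"
    if "A \<in> ?\<Omega>" "finite T" "subtree_closed T" "T \<subseteq> trees_over (carrier A)" for A T
    using conjunct2[OF e[OF that(1)]] that(2-4) by blast
  have hull: "\<exists>T. finite T \<and> subtree_closed T \<and> W \<subseteq> T \<and> T \<subseteq> trees_over S"
    if "finite W" "W \<subseteq> trees_over S" for W and S :: "'u set"
    using that
  proof (induction W rule: finite_induct)
    case empty
    show ?case by (rule exI[of _ "{}"]) (simp add: subtree_closed_def)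
  next
    case (insert w W)
    then obtain T where T: "finite T" "subtree_closed T" "W \<subseteq> T" "T \<subseteq> trees_over S" by auto
    obtain U where U: "finite U" "subtree_closed U" "w \<in> U" "U \<subseteq> trees_over (set_tree w)"
      by (rule finite_subtree_closed_hull)
    have "trees_over (set_tree w) \<subseteq> trees_over S" using insert.prems by auto
    then have "T \<union> U \<subseteq> trees_over S" using T(4) U(4) by blast
    moreover have "subtree_closed (T \<union> U)" using T(2) U(2) by (rule subtree_closed_Un)
    ultimately show ?case using T(1,3) U(1,3) by (intro exI[of _ "T \<union> U"]) blast
  qed
  have equivariant: "\<exists>g\<in>automorphisms L M. \<forall>w\<in>W. e B (map_tree f w) = g (e A w)"
    if A: "A \<in> ?\<Omega>" and B: "B \<in> ?\<Omega>" and f: "f \<in> embeddings L A B"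
      and W: "finite W" "W \<subseteq> trees_over (carrier A)" for A B f W
  proof -
    obtain T where T: "finite T" "subtree_closed T" "W \<subseteq> T" "T \<subseteq> trees_over (carrier A)"
      using hull[OF W] by blast
    have "map_tree f ` T \<subseteq> trees_over (carrier B)" using map_tree_in_trees_over[OF f] T(4) by blast
    then have eB: "free_on (\<eta> B) (?r B) (map_tree f ` T) (e B)"
      by (rule free[OF B finite_imageI[OF T(1)] subtree_closed_map[OF T(2)]])
    let ?X = "{a. Leaf a \<in> T}"
    have X: "finite ?X" "?X \<subseteq> carrier A"
      using finite_vimageI[OF T(1), of Leaf] T(4) by (auto simp: vimage_def inj_on_def)
    \<comment> \<open>Besides \<open>\<eta> A\<close> this is a second embedding of \<open>A\<close>
      into \<open>M\<close>; homogeneity conjugates the two on the labels that occur in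
      \<open>T\<close>.\<close>
    have "compose (carrier A) (\<eta> B) f \<in> embeddings L A M"
      using f \<eta>[OF B] omega_age_objectsD(1)[OF A] by (rule embeddings_compose)
    then obtain g where g: "g \<in> automorphisms L M"
      "\<forall>x\<in>generated L A ?X. g (\<eta> A x) = compose (carrier A) (\<eta> B) f x"
      using ultrahomogeneous_embeddings[OF hom str omega_age_objectsD(1)[OF A] \<eta>[OF A] _ X] by blast
    have "\<eta> B (f a) = g (\<eta> A a)" if "Leaf a \<in> T" for a
    proof -
      have a: "a \<in> ?X" using that by simp
      show ?thesis
        using bspec[OF g(2) subsetD[OF generated_superset a]] subsetD[OF X(2) a] by (simp add: compose_eq)
    qed
    then have leaves: "\<exists>g\<in>{g. restrict g ?C \<in> automorphisms L M}. \<forall>a. Leaf a \<in> T \<longrightarrow> \<eta> B (f a) = g (\<eta> A a)"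
      using g(1) automorphismsD(3)[OF g(1)] by (intro bexI[of _ g]) auto
    have "free_on (\<eta> A) (?r A) T (e B \<circ> map_tree f)"
      by (rule free_on_transfer[OF eB T(2,4) embeddingsD(2)[OF f] _ leaves])
        (rule strict_order_embedding_iff[OF M(2) f])
    moreover have "free_on (\<eta> A) (?r A) T (e A)" using A T(1,2,4) by (rule free)
    moreover note lin = strict_order_linear[OF M(2) \<eta>[OF A]]
    moreover have "total_on T (tree_order (?r A))"
      using total_on_tree_order[OF lin(3)] T(4) unfolding total_on_def by blast
    moreover have "\<eta> A a \<in> ?C" if "Leaf a \<in> T" for a
      using that X(2) embeddingsD(5)[OF \<eta>[OF A]] by blast
    ultimately obtain h where h: "restrict h ?C \<in> automorphisms L M"
      "\<forall>v\<in>T. (e B \<circ> map_tree f) v = h (e A v)"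
      using free_on_unique[OF T(1,2) lin(1,2), of "\<eta> A" "e A" "e B \<circ> map_tree f"] by blast
    have "\<forall>w\<in>W. e B (map_tree f w) = restrict h ?C (e A w)"
      using h(2) T(3,4) surj[OF A] by fastforce
    then show ?thesis using h(1) by blast
  qed
  have leaves: "(\<lambda>a\<in>carrier A. e A (Leaf a)) \<in> embeddings L A M" if A: "A \<in> ?\<Omega>" for A
  proof (rule embeddings_if_locally_embedding[OF omega_age_objectsD(1)[OF A]])
    show "(\<lambda>a\<in>carrier A. e A (Leaf a)) \<in> carrier A \<rightarrow>\<^sub>E ?C"
      using surj[OF A] by auto
    fix X assume X: "finite X" "X \<subseteq> carrier A"
    \<comment> \<open>A set of leaves is subtree-closed, so on finite \<open>X\<close> the leaf map
      is \<open>\<eta> A\<close> followed by an automorphism.\<close>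
    then have "free_on (\<eta> A) (?r A) (Leaf ` X) (e A)"
      by (intro free[OF A]) (auto simp: subtree_closed_def)
    then obtain g where g: "restrict g ?C \<in> automorphisms L M" "\<forall>a\<in>X. e A (Leaf a) = g (\<eta> A a)"
      using free_onD(2) by fastforce
    have "compose (carrier A) (restrict g ?C) (\<eta> A) \<in> embeddings L A M"
      using \<eta>[OF A] automorphismsD(1)[OF g(1)] omega_age_objectsD(1)[OF A] by (rule embeddings_compose)
    moreover have "\<forall>x\<in>X. (\<lambda>a\<in>carrier A. e A (Leaf a)) x = compose (carrier A) (restrict g ?C) (\<eta> A) x"
      using g(2) X(2) embeddingsD(5)[OF \<eta>[OF A]] by (auto simp: compose_eq)
    ultimately show "\<exists>h\<in>embeddings L A M. \<forall>x\<in>X. (\<lambda>a\<in>carrier A. e A (Leaf a)) x = h x" by blast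
  qed
  show ?thesis
    using surj equivariant leaves by (intro exI[of _ e] ballI conjI allI impI) simp_all
qed

text \<open>\<open>F A B f\<close> sends the value of a tree to the value of the relabelled tree,
  and \<open>\<eta>\<close> gives the values of leaves. Functoriality is inherited from
  \<open>map_tree\<close>.\<close>

lemma functor_into_fraisse_structure:
  fixes M :: "('f, 'r, 'a) fo_structure"
  assumes M: "fraisse_structure L M" "linearly_ordered_by L leq M" and ind: "local_swir L M ind"
  obtains \<eta> :: "('f, 'r, 'u) fo_structure \<Rightarrow> 'u \<Rightarrow> 'a"
    and F :: "('f, 'r, 'u) fo_structure \<Rightarrow> ('f, 'r, 'u) fo_structure \<Rightarrow> ('u \<Rightarrow> 'u) \<Rightarrow> 'a \<Rightarrow> 'a"
  where "\<And>A. A \<in> omega_age_objects L M \<Longrightarrow> \<eta> A \<in> embeddings L A M"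
    and "\<And>A B f. A \<in> omega_age_objects L M \<Longrightarrow> B \<in> omega_age_objects L M \<Longrightarrow> f \<in> embeddings L A B \<Longrightarrow>
      F A B f \<in> embeddings L M M"
    and "\<And>A B f a. A \<in> omega_age_objects L M \<Longrightarrow> B \<in> omega_age_objects L M \<Longrightarrow> f \<in> embeddings L A B \<Longrightarrow>
      a \<in> carrier A \<Longrightarrow> F A B f (\<eta> A a) = \<eta> B (f a)"
    and "\<And>A. A \<in> omega_age_objects L M \<Longrightarrow> F A A (\<lambda>x\<in>carrier A. x) = (\<lambda>x\<in>carrier M. x)"
    and "\<And>A B C f g. A \<in> omega_age_objects L M \<Longrightarrow> B \<in> omega_age_objects L M \<Longrightarrow>
      C \<in> omega_age_objects L M \<Longrightarrow> f \<in> embeddings L A B \<Longrightarrow> g \<in> embeddings L B C \<Longrightarrow>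
      F A C (compose (carrier A) g f) = compose (carrier M) (F B C g) (F A B f)"
proof -
  let ?\<Omega> = "omega_age_objects L M :: ('f, 'r, 'u) fo_structure set"
  let ?C = "carrier M"
  have str: "is_structure L M" using M(1) unfolding fraisse_structure_def by auto
  obtain e :: "('f, 'r, 'u) fo_structure \<Rightarrow> 'u tree \<Rightarrow> 'a" where
    surj: "\<And>A. A \<in> ?\<Omega> \<Longrightarrow> e A ` trees_over (carrier A) = ?C"
    and leaves: "\<And>A. A \<in> ?\<Omega> \<Longrightarrow> (\<lambda>a\<in>carrier A. e A (Leaf a)) \<in> embeddings L A M"
    and equiv: "\<And>A B f W. A \<in> ?\<Omega> \<Longrightarrow> B \<in> ?\<Omega> \<Longrightarrow> f \<in> embeddings L A B \<Longrightarrow> finite W \<Longrightarrow>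
      W \<subseteq> trees_over (carrier A) \<Longrightarrow> \<exists>g\<in>automorphisms L M. \<forall>w\<in>W. e B (map_tree f w) = g (e A w)"
    using tree_presentation_exists[OF M ind] by metis
  define pre where "pre A = inv_into (trees_over (carrier A)) (e A)" for A
  have pre: "pre A x \<in> trees_over (carrier A)" "e A (pre A x) = x" if "A \<in> ?\<Omega>" "x \<in> ?C" for A x
  proof -
    have x: "x \<in> e A ` trees_over (carrier A)" using surj[OF that(1)] that(2) by simp
    show "pre A x \<in> trees_over (carrier A)" unfolding pre_def using x by (rule inv_into_into)
    show "e A (pre A x) = x" unfolding pre_def using x by (rule f_inv_into_f)
  qed
  define F where "F A B f = (\<lambda>x\<in>?C. e B (map_tree f (pre A x)))" for A B :: "('f, 'r, 'u) fo_structure" and f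
  define \<eta> where "\<eta> A = (\<lambda>a\<in>carrier A. e A (Leaf a))" for A
  have eC: "e A w \<in> ?C" if "A \<in> ?\<Omega>" "w \<in> trees_over (carrier A)" for A w
    using that surj by blast
  \<comment> \<open>The result does not depend on the tree chosen by \<open>pre\<close>: on the two
    trees \<open>w\<close> and \<open>?v\<close> relabelling changes the values by one and the same
    automorphism, so equal values stay equal.\<close>
  have F: "F A B f (e A w) = e B (map_tree f w)"
    if A: "A \<in> ?\<Omega>" and B: "B \<in> ?\<Omega>" and f: "f \<in> embeddings L A B"
      and w: "w \<in> trees_over (carrier A)" for A B f w
  proof -
    let ?v = "pre A (e A w)"
    have v: "?v \<in> trees_over (carrier A)" "e A ?v = e A w" using pre[OF A eC[OF A w]] .
    obtain g where g: "\<forall>u\<in>{w, ?v}. e B (map_tree f u) = g (e A u)"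
      using equiv[OF A B f, of "{w, ?v}"] v(1) w by blast
    then show ?thesis using eC[OF A w] v(2) unfolding F_def by simp
  qed
  have FM: "F A B f \<in> embeddings L M M"
    if A: "A \<in> ?\<Omega>" and B: "B \<in> ?\<Omega>" and f: "f \<in> embeddings L A B" for A B f
  proof (rule embeddings_if_locally_embedding[OF str])
    have "e B (map_tree f (pre A x)) \<in> ?C" if "x \<in> ?C" for x
      using eC[OF B map_tree_in_trees_over[OF f pre(1)[OF A that]]] .
    then show "F A B f \<in> ?C \<rightarrow>\<^sub>E ?C" by (simp add: F_def)
    fix X assume X: "finite X" "X \<subseteq> ?C"
    have "pre A ` X \<subseteq> trees_over (carrier A)" using pre(1)[OF A] X(2) by blast
    \<comment> \<open>On each finite set \<open>F A B f\<close> agrees with an automorphism of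
      \<open>M\<close>, which makes it an embedding.\<close>
    then obtain g where g: "g \<in> automorphisms L M" "\<forall>w\<in>pre A ` X. e B (map_tree f w) = g (e A w)"
      using equiv[OF A B f finite_imageI[OF X(1)]] by blast
    have "F A B f x = g x" if "x \<in> X" for x
      using g(2) pre(2)[OF A] X(2) that by (auto simp: F_def)
    then show "\<exists>g\<in>embeddings L M M. \<forall>x\<in>X. F A B f x = g x" using automorphismsD(1)[OF g(1)] by blast
  qed
  show thesis
  proof (rule that[of \<eta> F])
    show "\<eta> A \<in> embeddings L A M" if "A \<in> ?\<Omega>" for A
      using leaves[OF that] unfolding \<eta>_def .
    show "F A B f \<in> embeddings L M M" if "A \<in> ?\<Omega>" "B \<in> ?\<Omega>" "f \<in> embeddings L A B" for A B f
      using that by (rule FM)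
    show "F A B f (\<eta> A a) = \<eta> B (f a)"
      if "A \<in> ?\<Omega>" "B \<in> ?\<Omega>" "f \<in> embeddings L A B" "a \<in> carrier A" for A B f a
      using F[OF that(1-3), of "Leaf a"] that(4) embeddingsD(5)[OF that(3,4)] by (simp add: \<eta>_def)
    show "F A A (\<lambda>x\<in>carrier A. x) = (\<lambda>x\<in>?C. x)" if A: "A \<in> ?\<Omega>" for A
    proof
      fix x
      have "map_tree (\<lambda>x\<in>carrier A. x) w = w" if "w \<in> trees_over (carrier A)" for w
        using that by (intro trans[OF tree.map_cong0 tree.map_ident]) auto
      then show "F A A (\<lambda>x\<in>carrier A. x) x = (\<lambda>x\<in>?C. x) x"
        using pre[OF A, of x] by (simp add: F_def)
    qed
    show "F A C (compose (carrier A) g f) = compose ?C (F B C g) (F A B f)"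
      if A: "A \<in> ?\<Omega>" and B: "B \<in> ?\<Omega>" and C: "C \<in> ?\<Omega>"
        and f: "f \<in> embeddings L A B" and g: "g \<in> embeddings L B C" for A B C f g
    proof
      fix x
      show "F A C (compose (carrier A) g f) x = compose ?C (F B C g) (F A B f) x"
      proof (cases "x \<in> ?C")
        case True
        let ?w = "pre A x"
        have w: "?w \<in> trees_over (carrier A)" using pre(1)[OF A True] .
        have "map_tree (compose (carrier A) g f) ?w = map_tree (g \<circ> f) ?w"
          using w by (intro tree.map_cong0) (auto simp: compose_eq)
        then have "F A C (compose (carrier A) g f) x = e C (map_tree g (map_tree f ?w))"
          using True by (simp add: F_def tree.map_comp)
        also have "\<dots> = F B C g (e B (map_tree f ?w))"
          using F[OF B C g map_tree_in_trees_over[OF f w]] by simp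
        also have "\<dots> = compose ?C (F B C g) (F A B f) x"
          using True by (simp add: compose_eq F_def[of A B f])
        finally show ?thesis .
      next
        case False
        then show ?thesis by (simp add: F_def compose_def)
      qed
    qed
  qed
qed

section \<open>The Katetov functor\<close>

text \<open>The functor takes values in structures over the universe \<open>'u\<close>, whereas
  \<open>M\<close> lives in a type of its own; an infinite universe has room for a copy of a
  countable structure.\<close>

lemma isomorphic_copy_exists:
  fixes M :: "('f, 'r, 'a) fo_structure"
  assumes "infinite (UNIV :: 'u set)" "is_structure L M" "countable (carrier M)"
  obtains N :: "('f, 'r, 'u) fo_structure" and i where "is_structure L N" "i \<in> isomorphisms L M N"
proof -
  let ?C = "carrier M"
  obtain \<nu> :: "nat \<Rightarrow> 'u" where "inj \<nu>" using infinite_countable_subset[OF assms(1)] by blast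
  then have inj: "inj_on (\<nu> \<circ> to_nat_on ?C) ?C"
    using inj_on_to_nat_on[OF assms(3)] by (auto intro!: comp_inj_on inj_on_subset[of \<nu> UNIV])
  define i where "i = restrict (\<nu> \<circ> to_nat_on ?C) ?C"
  have i: "inj_on i ?C" using inj unfolding i_def by (simp add: inj_on_restrict_eq)
  define j where "j = inv_into ?C i"
  have map_ji: "map j (map i xs) = xs" if "xs \<in> tuples ?C n" for xs n
    using that inv_into_f_f[OF i] unfolding map_map j_def by (intro map_idI) (auto simp: tuples_def)
  define N :: "('f, 'r, 'u) fo_structure"
    where "N = \<lparr>carrier = i ` ?C, fn = \<lambda>f xs. i (fn M f (map j xs)), rel = \<lambda>R. {xs. map j xs \<in> rel M R}\<rparr>"
  have "i \<in> embeddings L M N"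
  proof (rule embeddingsI)
    show "i \<in> ?C \<rightarrow>\<^sub>E carrier N" by (auto simp: N_def i_def)
    show "inj_on i ?C" by (rule i)
    show "i (fn M f xs) = fn N f (map i xs)" if "xs \<in> tuples ?C (fun_arity L f)" for f xs
      using map_ji[OF that] by (simp add: N_def del: map_map)
    show "xs \<in> rel M R \<longleftrightarrow> map i xs \<in> rel N R" if "xs \<in> tuples ?C (rel_arity L R)" for R xs
      using map_ji[OF that] by (simp add: N_def del: map_map)
  qed
  moreover have N: "carrier N = i ` ?C" by (simp add: N_def)
  ultimately have "i \<in> isomorphisms L M N" "is_structure L N"
    using fun_closed_image[of i L M N ?C] assms(2) by (auto simp: isomorphisms_def is_structure_def)
  then show thesis using that by blast
qed

text \<open>The constant object is the copy \<open>N\<close> of \<open>M\<close>, and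
  \<open>Km\<close> is the action on \<open>M\<close> conjugated by \<open>i\<close>. The extension
  property is homogeneity: since \<open>A\<close> is finitely generated, any embedding of
  \<open>B\<close> into \<open>M\<close> can be moved by an automorphism so that it becomes
  \<open>\<eta> A\<close> on \<open>A\<close>.\<close>

lemma katetov_functor_exists:
  fixes M :: "('f, 'r, 'a) fo_structure"
  assumes U: "infinite (UNIV :: 'u set)" and M: "fraisse_structure L M" "linearly_ordered_by L leq M"
    and ind: "local_swir L M ind"
  shows "\<exists>(Ko :: ('f, 'r, 'u) fo_structure \<Rightarrow> ('f, 'r, 'u) fo_structure) Km \<eta>. katetov_functor L M Ko Km \<eta>"
proof -
  let ?C = "carrier M"
  have str: "is_structure L M" and cnt: "countable ?C" and hom: "ultrahomogeneous L M" and ne: "?C \<noteq> {}"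
    using M(1) unfolding fraisse_structure_def by auto
  obtain N :: "('f, 'r, 'u) fo_structure" and i where N: "is_structure L N" "i \<in> isomorphisms L M N"
    by (rule isomorphic_copy_exists[OF U str cnt])
  define j where "j = restrict (inv_into ?C i) (carrier N)"
  have j: "j \<in> isomorphisms L N M" using isomorphisms_inverse[OF N(2) str] unfolding j_def .
  note iE = isomorphismsD(1)[OF N(2)] and jE = isomorphismsD(1)[OF j]
  have ji: "j (i x) = x" if "x \<in> ?C" for x
    using inv_into_f_f[OF embeddingsD(2)[OF iE] that] embeddingsD(5)[OF iE that] by (simp add: j_def)
  have ij: "i (j y) = y" if "y \<in> carrier N" for y
    using that f_inv_into_f[of y i ?C] isomorphismsD(2)[OF N(2)] by (simp add: j_def)
  have jC: "j y \<in> ?C" if "y \<in> carrier N" for y using embeddingsD(5)[OF jE that] .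
  let ?\<Omega> = "omega_age_objects L M :: ('f, 'r, 'u) fo_structure set"
  obtain \<eta> :: "('f, 'r, 'u) fo_structure \<Rightarrow> 'u \<Rightarrow> 'a" and F where
    \<eta>: "\<And>A. A \<in> ?\<Omega> \<Longrightarrow> \<eta> A \<in> embeddings L A M"
    and F: "\<And>A B f. A \<in> ?\<Omega> \<Longrightarrow> B \<in> ?\<Omega> \<Longrightarrow> f \<in> embeddings L A B \<Longrightarrow> F A B f \<in> embeddings L M M"
    and F\<eta>: "\<And>A B f a. A \<in> ?\<Omega> \<Longrightarrow> B \<in> ?\<Omega> \<Longrightarrow> f \<in> embeddings L A B \<Longrightarrow> a \<in> carrier A \<Longrightarrow>
      F A B f (\<eta> A a) = \<eta> B (f a)"
    and F_id: "\<And>A. A \<in> ?\<Omega> \<Longrightarrow> F A A (\<lambda>x\<in>carrier A. x) = (\<lambda>x\<in>?C. x)"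
    and F_comp: "\<And>A B C f g. A \<in> ?\<Omega> \<Longrightarrow> B \<in> ?\<Omega> \<Longrightarrow> C \<in> ?\<Omega> \<Longrightarrow> f \<in> embeddings L A B \<Longrightarrow>
      g \<in> embeddings L B C \<Longrightarrow> F A C (compose (carrier A) g f) = compose ?C (F B C g) (F A B f)"
    using functor_into_fraisse_structure[OF M ind] by blast
  have age: "A \<in> ?\<Omega>" "fin_gen L A" if "A \<in> age_objects L M" for A
    using that unfolding age_objects_def age_def omega_age_objects_def by auto
  define Km where "Km A B f = compose (carrier N) (compose ?C i (F A B f)) j" for A B f
  define \<iota> where "\<iota> A = compose (carrier A) i (\<eta> A)" for A
  have Km_eq: "Km A B f y = i (F A B f (j y))" if "y \<in> carrier N" for A B f y
    using that jC by (simp add: Km_def compose_eq)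
  have FC: "F A B f x \<in> ?C" if "A \<in> ?\<Omega>" "B \<in> ?\<Omega>" "f \<in> embeddings L A B" "x \<in> ?C" for A B f x
    using embeddingsD(5)[OF F[OF that(1-3)] that(4)] .
  have \<iota>: "\<iota> A \<in> embeddings L A N" if "A \<in> ?\<Omega>" for A
    unfolding \<iota>_def using \<eta>[OF that] iE omega_age_objectsD(1)[OF that] by (rule embeddings_compose)
  have "embedding_functor L (age_objects L M) ?\<Omega> (\<lambda>_. N) Km"
    unfolding embedding_functor_def
  proof (intro conjI ballI)
    show "N \<in> ?\<Omega>"
      using N(1) jE isomorphismsD(2)[OF N(2)] ne unfolding omega_age_objects_def omega_age_def by auto
    show "Km A B f \<in> embeddings L N N"
      if "A \<in> age_objects L M" "B \<in> age_objects L M" "f \<in> embeddings L A B" for A B f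
      unfolding Km_def
      using embeddings_compose[OF jE embeddings_compose[OF F[OF age(1)[OF that(1)] age(1)[OF that(2)] that(3)] iE str] N(1)] .
    show "Km A A (\<lambda>x\<in>carrier A. x) = (\<lambda>x\<in>carrier N. x)" if A: "A \<in> age_objects L M" for A
    proof
      fix y show "Km A A (\<lambda>x\<in>carrier A. x) y = (\<lambda>x\<in>carrier N. x) y"
        using ij jC by (cases "y \<in> carrier N") (simp_all add: Km_eq F_id[OF age(1)[OF A]], simp add: Km_def compose_def)
    qed
    show "Km A C (compose (carrier A) g f) = compose (carrier N) (Km B C g) (Km A B f)"
      if "A \<in> age_objects L M" "B \<in> age_objects L M" "C \<in> age_objects L M"
        "f \<in> embeddings L A B" "g \<in> embeddings L B C" for A B C f g
    proof
      fix y
      note o = age(1)[OF that(1)] age(1)[OF that(2)] age(1)[OF that(3)]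
      show "Km A C (compose (carrier A) g f) y = compose (carrier N) (Km B C g) (Km A B f) y"
      proof (cases "y \<in> carrier N")
        case True
        have Fy: "F A B f (j y) \<in> ?C" using FC[OF o(1,2) that(4) jC[OF True]] .
        have "Km A C (compose (carrier A) g f) y = i (F B C g (F A B f (j y)))"
          using True F_comp[OF o that(4,5)] jC by (simp add: Km_eq compose_eq)
        also have "\<dots> = Km B C g (Km A B f y)"
          using True Fy embeddingsD(5)[OF iE Fy] by (simp add: Km_eq ji)
        finally show ?thesis using True by (simp add: compose_eq)
      next
        case False
        then show ?thesis by (simp add: Km_def compose_def)
      qed
    qed
  qed
  moreover have "compose (carrier A) (Km A B f) (\<iota> A) = compose (carrier A) (\<iota> B) f"
    if "A \<in> age_objects L M" "B \<in> age_objects L M" "f \<in> embeddings L A B" for A B f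
  proof
    fix a
    note o = age(1)[OF that(1)] age(1)[OF that(2)]
    show "compose (carrier A) (Km A B f) (\<iota> A) a = compose (carrier A) (\<iota> B) f a"
    proof (cases "a \<in> carrier A")
      case True
      have "\<eta> A a \<in> ?C" using embeddingsD(5)[OF \<eta>[OF o(1)] True] .
      then show ?thesis
        using True F\<eta>[OF o that(3) True] embeddingsD(5)[OF that(3) True] embeddingsD(5)[OF iE]
        by (simp add: compose_eq \<iota>_def Km_eq ji)
    next
      case False
      then show ?thesis by (simp add: compose_def)
    qed
  qed
  moreover have "\<exists>f\<in>embeddings L B N. compose (carrier A) f \<zeta> = \<iota> A"
    if A: "A \<in> age_objects L M" and B: "B \<in> age_objects L M" and \<zeta>: "one_point_extension L A B \<zeta>" for A B \<zeta>
  proof -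
    have \<zeta>E: "\<zeta> \<in> embeddings L A B" using \<zeta> unfolding one_point_extension_def by simp
    note sA = omega_age_objectsD(1)[OF age(1)[OF A]] and sB = omega_age_objectsD(1)[OF age(1)[OF B]]
    obtain \<beta> where \<beta>: "\<beta> \<in> embeddings L B M" using omega_age_objectsD(2)[OF age(1)[OF B]] by blast
    obtain X where X: "finite X" "X \<subseteq> carrier A" "carrier A = generated L A X"
      using age(2)[OF A] unfolding fin_gen_def fin_gen_sub_def by blast
    \<comment> \<open>As \<open>X\<close> generates \<open>A\<close>, the two embeddings become
      equal on all of \<open>A\<close>.\<close>
    obtain g where g: "g \<in> automorphisms L M" "\<forall>x\<in>generated L A X. g (compose (carrier A) \<beta> \<zeta> x) = \<eta> A x"
      using ultrahomogeneous_embeddings[OF hom str sA embeddings_compose[OF \<zeta>E \<beta> sA] \<eta>[OF age(1)[OF A]] X(1,2)]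
      by blast
    let ?f = "compose (carrier B) (compose ?C i g) \<beta>"
    have "?f \<in> embeddings L B N"
      using embeddings_compose[OF \<beta> embeddings_compose[OF automorphismsD(1)[OF g(1)] iE str] sB] .
    moreover have "compose (carrier A) ?f \<zeta> = \<iota> A"
    proof
      fix a
      show "compose (carrier A) ?f \<zeta> a = \<iota> A a"
      proof (cases "a \<in> carrier A")
        case True
        then have "g (\<beta> (\<zeta> a)) = \<eta> A a" using g(2) X(3) by (simp add: compose_eq)
        then show ?thesis
          using True embeddingsD(5)[OF \<zeta>E True] embeddingsD(5)[OF \<beta>] by (simp add: compose_eq \<iota>_def)
      next
        case False
        then show ?thesis by (simp add: compose_def \<iota>_def)
      qed
    qed
    ultimately show ?thesis by blast
  qed
  ultimately have "katetov_functor L M (\<lambda>_. N) Km \<iota>"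
    using \<iota> age(1) unfolding katetov_functor_def by simp
  then show ?thesis by blast
qed

section \<open>Extensibility of the \<omega>-age\<close>

lemma automorphisms_subset_Bij: "automorphisms L A \<subseteq> Bij (carrier A)"
proof
  fix g assume g: "g \<in> automorphisms L A"
  show "g \<in> Bij (carrier A)"
    using embeddingsD(1,2)[OF automorphismsD(1)[OF g]] automorphismsD(2)[OF g]
    unfolding Bij_def bij_betw_def PiE_def by blast
qed

lemma carrier_aut_group [simp]: "carrier (aut_group L A) = automorphisms L A"
  by (simp add: aut_group_def)

lemma mult_aut_group:
  "g \<in> automorphisms L A \<Longrightarrow> h \<in> automorphisms L A \<Longrightarrow> g \<otimes>\<^bsub>aut_group L A\<^esub> h = compose (carrier A) g h"
  using automorphisms_subset_Bij by (auto simp: aut_group_def BijGroup_def subset_iff)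

text \<open>The functor covers non-empty structures only, whereas the \<omega>-age may contain empty
  ones. For these the automorphism group of the image is trivial.\<close>

lemma extensive_embedding_empty:
  assumes str: "is_structure L M" and f: "f \<in> embeddings L A M" and A: "carrier A = {}"
  shows "extensive_embedding L A M f"
proof -
  let ?D = "induced M (f ` carrier A)"
  let ?\<theta> = "\<lambda>_. \<lambda>x\<in>carrier M. x"
  have id: "(\<lambda>x\<in>carrier M. x) \<in> automorphisms L M" by (rule id_automorphism[OF str])
  have "g = (\<lambda>_. undefined)" if "g \<in> automorphisms L ?D" for g
    using embeddingsD(1)[OF automorphismsD(1)[OF that]] A by simp
  then have "inj_on ?\<theta> (automorphisms L ?D)" by (intro inj_onI) metis
  moreover have "compose (carrier M) (\<lambda>x\<in>carrier M. x) (\<lambda>x\<in>carrier M. x) = (\<lambda>x\<in>carrier M. x)"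
    by (auto simp: compose_def)
  ultimately have "?\<theta> \<in> mon (aut_group L ?D) (aut_group L M)"
    using id mult_aut_group[OF id id] by (simp add: mon_def hom_def)
  then show ?thesis using f A unfolding extensive_embedding_def by auto
qed

text \<open>Automorphisms of the image of \<open>f\<close> are transported to \<open>A\<close> and
  fed to the functor. Functoriality makes the result multiplicative and sends invertible morphisms
  to invertible ones. Compatibility with the embeddings \<open>\<eta>\<close> makes it extend the
  given automorphism, which also gives injectivity.\<close>

lemma omega_age_extensible:
  fixes M :: "('f, 'r, 'a) fo_structure"
  assumes M: "fraisse_structure L M" "linearly_ordered_by L leq M" and ind: "local_swir L M ind"
  shows "extensible L (omega_age L M :: ('f, 'r, 'u) fo_structure set) M"
  unfolding extensible_def
proof
  fix A :: "('f, 'r, 'u) fo_structure"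
  assume A\<omega>: "A \<in> omega_age L M"
  let ?C = "carrier M"
  let ?\<Omega> = "omega_age_objects L M :: ('f, 'r, 'u) fo_structure set"
  have str: "is_structure L M" using M(1) unfolding fraisse_structure_def by auto
  show "\<exists>f. extensive_embedding L A M f"
  proof (cases "carrier A = {}")
    case True
    obtain f where "f \<in> embeddings L A M" using A\<omega> unfolding omega_age_def by blast
    then show ?thesis using extensive_embedding_empty[OF str _ True] by blast
  next
    case False
    then have A: "A \<in> ?\<Omega>" using A\<omega> unfolding omega_age_objects_def by simp
    note sA = omega_age_objectsD(1)[OF A]
    obtain \<eta> :: "('f, 'r, 'u) fo_structure \<Rightarrow> 'u \<Rightarrow> 'a" and F where
      \<eta>: "\<And>A. A \<in> ?\<Omega> \<Longrightarrow> \<eta> A \<in> embeddings L A M"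
      and F: "\<And>A B f. A \<in> ?\<Omega> \<Longrightarrow> B \<in> ?\<Omega> \<Longrightarrow> f \<in> embeddings L A B \<Longrightarrow> F A B f \<in> embeddings L M M"
      and F\<eta>: "\<And>A B f a. A \<in> ?\<Omega> \<Longrightarrow> B \<in> ?\<Omega> \<Longrightarrow> f \<in> embeddings L A B \<Longrightarrow> a \<in> carrier A \<Longrightarrow>
        F A B f (\<eta> A a) = \<eta> B (f a)"
      and F_id: "\<And>A. A \<in> ?\<Omega> \<Longrightarrow> F A A (\<lambda>x\<in>carrier A. x) = (\<lambda>x\<in>?C. x)"
      and F_comp: "\<And>A B C f g. A \<in> ?\<Omega> \<Longrightarrow> B \<in> ?\<Omega> \<Longrightarrow> C \<in> ?\<Omega> \<Longrightarrow> f \<in> embeddings L A B \<Longrightarrow>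
        g \<in> embeddings L B C \<Longrightarrow> F A C (compose (carrier A) g f) = compose ?C (F B C g) (F A B f)"
      using functor_into_fraisse_structure[OF M ind] by blast
    define f where "f = \<eta> A"
    let ?S = "f ` carrier A"
    let ?D = "induced M ?S"
    have f: "f \<in> embeddings L A M" unfolding f_def by (rule \<eta>[OF A])
    have f_iso: "f \<in> isomorphisms L A ?D" using f sA by (rule embedding_onto_image)
    have sD: "is_structure L ?D"
      using fun_closed_image[OF f order.refl] sA is_structure_induced unfolding is_structure_def[of L A] by blast
    define k where "k = restrict (inv_into (carrier A) f) ?S"
    have k_iso: "k \<in> isomorphisms L ?D A" using isomorphisms_inverse[OF f_iso sA] by (simp add: k_def)
    have kf: "k (f a) = a" if "a \<in> carrier A" for a
      using inv_into_f_f[OF embeddingsD(2)[OF f] that] that by (simp add: k_def)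
    have fk: "f (k x) = x" "k x \<in> carrier A" if "x \<in> ?S" for x
      using f_inv_into_f[OF that] inv_into_into[OF that] that by (simp_all add: k_def)
    \<comment> \<open>The self-map of \<open>A\<close> that corresponds to \<open>g\<close> under
      \<open>f\<close>.\<close>
    define c where "c g = compose (carrier A) (compose ?S k g) f" for g
    have gS: "g x \<in> ?S" if "g \<in> automorphisms L ?D" "x \<in> ?S" for g x
      using automorphismsD(4)[OF that(1)] that(2) by simp
    have c_eq: "c g a = k (g (f a))" if "a \<in> carrier A" for g a
      using that by (simp add: c_def compose_eq)
    have c: "c g \<in> embeddings L A A" if "g \<in> automorphisms L ?D" for g
    proof -
      have "compose ?S k g \<in> isomorphisms L ?D A"
        using isomorphisms_compose[OF that[unfolded automorphisms_def] k_iso sD] by simp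
      then show ?thesis
        using isomorphismsD(1)[OF isomorphisms_compose[OF f_iso _ sA]] unfolding c_def by blast
    qed
    have c_comp: "c (compose ?S g h) = compose (carrier A) (c g) (c h)"
      if "g \<in> automorphisms L ?D" "h \<in> automorphisms L ?D" for g h
    proof
      fix a
      show "c (compose ?S g h) a = compose (carrier A) (c g) (c h) a"
      proof (cases "a \<in> carrier A")
        case True
        have "h (f a) \<in> ?S" using gS[OF that(2)] True by blast
        then show ?thesis using True fk by (simp add: compose_eq c_eq)
      next
        case False
        then show ?thesis by (simp add: c_def compose_def)
      qed
    qed
    have c_id: "c (\<lambda>x\<in>?S. x) = (\<lambda>a\<in>carrier A. a)"
    proof
      fix a show "c (\<lambda>x\<in>?S. x) a = (\<lambda>a\<in>carrier A. a) a"
        using kf by (cases "a \<in> carrier A") (simp_all add: c_eq, simp add: c_def compose_def)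
    qed
    define \<theta> where "\<theta> g = F A A (c g)" for g
    have \<theta>_comp: "\<theta> (compose ?S g h) = compose ?C (\<theta> g) (\<theta> h)"
      if "g \<in> automorphisms L ?D" "h \<in> automorphisms L ?D" for g h
      unfolding \<theta>_def c_comp[OF that] using A A A c[OF that(2)] c[OF that(1)] by (rule F_comp)
    have \<theta>_aut: "\<theta> g \<in> automorphisms L M" if g: "g \<in> automorphisms L ?D" for g
    proof -
      \<comment> \<open>A priori \<open>\<theta> g\<close> is only a self-embedding of
        \<open>M\<close>. The inverse \<open>?h\<close> of \<open>g\<close> gives it the right
        inverse \<open>\<theta> ?h\<close>, hence surjectivity.\<close>
      let ?h = "restrict (inv_into ?S g) ?S"
      have h: "?h \<in> automorphisms L ?D"
        using isomorphisms_inverse[of g L ?D ?D] g sD unfolding automorphisms_def by simp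
      have "compose ?S g ?h = (\<lambda>x\<in>?S. x)"
      proof
        fix x show "compose ?S g ?h x = (\<lambda>x\<in>?S. x) x"
          using f_inv_into_f[of x g ?S] automorphismsD(2)[OF g] by (simp add: compose_def)
      qed
      then have "compose ?C (\<theta> g) (\<theta> ?h) = (\<lambda>x\<in>?C. x)"
        using \<theta>_comp[OF g h] c_id F_id[OF A] by (simp add: \<theta>_def)
      then have right_inv: "\<theta> g (\<theta> ?h x) = x" if "x \<in> ?C" for x
        using that by (metis compose_eq restrict_apply')
      have E: "\<theta> g \<in> embeddings L M M" "\<theta> ?h \<in> embeddings L M M"
        unfolding \<theta>_def using F[OF A A c[OF g]] F[OF A A c[OF h]] .
      have "x \<in> \<theta> g ` ?C" if "x \<in> ?C" for x
        using right_inv[OF that] embeddingsD(5)[OF E(2) that] by (metis image_eqI)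
      then have "\<theta> g ` ?C = ?C" using embeddingsD(5)[OF E(1)] by blast
      then show ?thesis using E(1) unfolding automorphisms_def isomorphisms_def by simp
    qed
    have extends: "\<theta> g x = g x" if g: "g \<in> automorphisms L ?D" and x: "x \<in> ?S" for g x
    proof -
      obtain a where a: "a \<in> carrier A" "x = f a" using x by blast
      have "\<theta> g x = f (c g a)" using F\<eta>[OF A A c[OF g] a(1)] a(2) by (simp add: \<theta>_def f_def)
      then show ?thesis using fk(1)[OF gS[OF g x]] a by (simp add: c_eq)
    qed
    have "inj_on \<theta> (automorphisms L ?D)"
    proof (rule inj_onI)
      fix g h assume gh: "g \<in> automorphisms L ?D" "h \<in> automorphisms L ?D" "\<theta> g = \<theta> h"
      have "restrict g ?S = restrict h ?S"
        using extends[OF gh(1)] extends[OF gh(2)] gh(3) by (intro restrict_ext) simp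
      then show "g = h" using automorphismsD(3)[OF gh(1)] automorphismsD(3)[OF gh(2)] by simp
    qed
    moreover have "\<theta> (g \<otimes>\<^bsub>aut_group L ?D\<^esub> h) = \<theta> g \<otimes>\<^bsub>aut_group L M\<^esub> \<theta> h"
      if "g \<in> automorphisms L ?D" "h \<in> automorphisms L ?D" for g h
      using mult_aut_group[OF that] mult_aut_group[OF \<theta>_aut[OF that(1)] \<theta>_aut[OF that(2)]] \<theta>_comp[OF that]
      by simp
    ultimately have "\<theta> \<in> mon (aut_group L ?D) (aut_group L M)"
      using \<theta>_aut by (auto simp: mon_def hom_def)
    then show ?thesis using f extends unfolding extensive_embedding_def by blast
  qed
qed

theorem theorem4p4:
  fixes L :: "('f, 'r) language"
    and leq :: 'r
    and M :: "('f, 'r, 'a) fo_structure"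
  assumes "infinite (UNIV :: 'u set)"
    and "fraisse_structure L M"
    and "linearly_ordered_by L leq M"
    and "strong_amalgamation L (age L M :: ('f, 'r, 'u) fo_structure set)"
    and "\<exists>ind. local_swir L M ind"
  shows "(\<exists>(Ko :: ('f, 'r, 'u) fo_structure \<Rightarrow> ('f, 'r, 'u) fo_structure) Km \<eta>.
            katetov_functor L M Ko Km \<eta>) \<and>
         extensible L (omega_age L M :: ('f, 'r, 'u) fo_structure set) M"
  using assms(5) katetov_functor_exists[OF assms(1-3)] omega_age_extensible[OF assms(2,3)] by blast

end
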